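(* Let $\mathcal{C}$ be a locally semiadditive and compositionally distributive 2-category, let $A,B$ be objects with a weak 2-coproduct $(A\sqcup B,i_A,i_B)$ and a weak 2-product $(A\times B,p_A,p_B)$, and let $r:A\sqcup B\to A\times B$ be a canonical 1-morphism. Then $r$ is an equivalence if and only if the projections and injections satisfy the conditions of a weak 2-biproduct, i.e. there exist 2-isomorphisms $\theta_A,\theta_B,\theta_{AB},\theta_{BA},\theta_P$ such that $(A\times B,\,p_A,\,p_B,\,r i_A,\,r i_B,\,\theta_A,\theta_B,\theta_{AB},\theta_{BA},\theta_P)$ is a weak 2-biproduct of $A$ and $B$.
   Context: A 2-category means a strict 2-category. Horizontal composition is written by juxtaposition, vertical composition of 2-morphisms by $\odot$; whiskering of a 2-morphism $\alpha$ by a 1-morphism $f$ is written $f\alpha$ or $\alpha f$. Locally semiadditive: every Hom-category $Hom(X,Y)$ is semiadditive, i.e. has finite biproducts. Biproducts of 1-morphisms are written $\oplus$, with projection and injection 2-morphisms $\pi,\nu$; the induced addition of parallel 2-morphisms is $+$; $0_{Y,X}$ denotes the zero object of $Hom(X,Y)$ (zero 1-morphism $X\to Y$). Compositionally distributive: 2-morphisms distribute over addition of 2-morphisms, i.e. $\gamma(\alpha+\beta)=\gamma\alpha+\gamma\beta$, $(\alpha+\beta)\gamma=\alpha\gamma+\beta\gamma$ (horizontal composition) and $\alpha\odot(\beta+\gamma)=\alpha\odot\beta+\alpha\odot\gamma$ whenever the composites are defined. Weak 2-product of $A,B$: an object $P$ with 1-morphisms $p_A:P\to A$, $p_B:P\to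 B$ such that: (i) for every object $X$ with 1-morphisms $f:X\to A$, $g:X\to B$ there exist a 1-morphism $b:X\to P$ and 2-isomorphisms $\xi_A:p_Ab\Rightarrow f$, $\xi_B:p_Bb\Rightarrow g$; (ii) for any other such cone $f':X\to A$, $g':X\to B$ with corresponding $b':X\to P$ and 2-isomorphisms $\xi'_A:p_Ab'\Rightarrow f'$, $\xi'_B:p_Bb'\Rightarrow g'$, and any 2-morphisms $\Sigma_A:f\Rightarrow f'$, $\Sigma_B:g\Rightarrow g'$, there is a unique 2-morphism $\gamma:b\Rightarrow b'$ with $p_A\gamma=(\xi'_A)^{-1}\odot\Sigma_A\odot\xi_A$ and $p_B\gamma=(\xi'_B)^{-1}\odot\Sigma_B\odot\xi_B$. Weak 2-coproduct of $A,B$: the dual notion, an object with 1-morphisms $i_A,i_B$ from $A,B$ into it having the same universal property with all 1-morphisms reversed. Canonical 1-morphism: a 1-morphism $r:A\sqcup B\to A\times B$ for which there are 2-isomorphisms $p_Ari_A\Rightarrow id_A$, $p_Bri_B\Rightarrow id_B$, $p_Ari_B\Rightarrow 0_{A,B}$, $p_Bri_A\Rightarrow 0_{B,A}$. Equivalence: there is a 1-morphism $r':A\times B\to A\sqcup B$ with 2-isomorphisms $\xi_{A\times B}:rr'\Rightarrow id_{A\times B}$ and $\xi_{A\sqcup B}:id_{A\sqcup B}\Rightarrow r'r$ satisfying $(r'\xi_{A\times B})\odot(\xi_{A\sqcup B}r')=1_{r'}$ and $(\xi_{A\times B}r)\odot(r\xi_{A\sqcup B})=1_r$. Weak 2-biproduct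 of $A,B$: a tuple $(P,p_A,p_B,j_A,j_B,\theta_A,\theta_B,\theta_{AB},\theta_{BA},\theta_P)$ with 1-morphisms $p_A:P\to A$, $p_B:P\to B$, $j_A:A\to P$, $j_B:B\to P$ and 2-isomorphisms $\theta_A:p_Aj_A\Rightarrow id_A$, $\theta_B:p_Bj_B\Rightarrow id_B$, $\theta_{BA}:p_Bj_A\Rightarrow 0_{B,A}$, $\theta_{AB}:p_Aj_B\Rightarrow 0_{A,B}$, $\theta_P:j_Ap_A\oplus j_Bp_B\Rightarrow id_P$, satisfying $$p_A\theta_Pj_A=\begin{bmatrix}(p_Aj_A)\theta_A&0\\0&0\end{bmatrix},\qquad p_B\theta_Pj_B=\begin{bmatrix}0&0\\0&(p_Bj_B)\theta_B\end{bmatrix}.$$ Here the matrices are taken with respect to the decompositions of the sources $p_A(j_Ap_A\oplus j_Bp_B)j_A\cong p_Aj_Ap_Aj_A\oplus p_Aj_Bp_Bj_A$ and $p_B(j_Ap_A\oplus j_Bp_B)j_B\cong p_Bj_Ap_Aj_B\oplus p_Bj_Bp_Bj_B$, and of the targets $p_Aj_A\cong p_Aj_A\oplus 0$ and $p_Bj_B\cong 0\oplus p_Bj_B$; that is, $p_A\theta_Pj_A=((p_Aj_A)\theta_A)\odot(p_A\pi_1j_A)$ and $p_B\theta_Pj_B=((p_Bj_B)\theta_B)\odot(p_B\pi_2j_B)$, where $\pi_1,\pi_2$ are the projections of $j_Ap_A\oplus j_Bp_B$ onto $j_Ap_A$ and $j_Bp_B$. *)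

theory Defs
  imports Main
begin

section \<open>Strict 2-categories\<close>

text \<open>
  Composition is written in the order of function composition: \<^term>\<open>comp1 C g f\<close> is
  ``first f, then g'', and likewise for the vertical and the horizontal composition of
  2-morphisms.  All operations are total functions; their values matter only on
  composable arguments.
\<close>

record ('o, 'a, 'c) two_cat =
  Obj :: "'o set"
  Mor1 :: "'a set"
  Mor2 :: "'c set"
  dom1 :: "'a \<Rightarrow> 'o"
  cod1 :: "'a \<Rightarrow> 'o"
  dom2 :: "'c \<Rightarrow> 'a"
  cod2 :: "'c \<Rightarrow> 'a"
  id1 :: "'o \<Rightarrow> 'a"
  id2 :: "'a \<Rightarrow> 'c"
  comp1 :: "'a \<Rightarrow> 'a \<Rightarrow> 'a"  (infixl "\<cdot>\<index>" 75)
  hcomp :: "'c \<Rightarrow> 'c \<Rightarrow> 'c"  (infixl "\<star>\<index>" 75)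
  vcomp :: "'c \<Rightarrow> 'c \<Rightarrow> 'c"  (infixl "\<odot>\<index>" 70)

definition hom1 :: "('o, 'a, 'c, 'z) two_cat_scheme \<Rightarrow> 'o \<Rightarrow> 'o \<Rightarrow> 'a set"
  where "hom1 C X Y = {f \<in> Mor1 C. dom1 C f = X \<and> cod1 C f = Y}"

definition hom2 :: "('o, 'a, 'c, 'z) two_cat_scheme \<Rightarrow> 'a \<Rightarrow> 'a \<Rightarrow> 'c set"
  where "hom2 C f g = {\<alpha> \<in> Mor2 C. dom2 C \<alpha> = f \<and> cod2 C \<alpha> = g}"

locale two_category =
  fixes C :: "('o, 'a, 'c, 'z) two_cat_scheme" (structure)
  assumes dom1_Obj: "f \<in> Mor1 C \<Longrightarrow> dom1 C f \<in> Obj C"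
    and cod1_Obj: "f \<in> Mor1 C \<Longrightarrow> cod1 C f \<in> Obj C"
    and dom2_Mor1: "\<alpha> \<in> Mor2 C \<Longrightarrow> dom2 C \<alpha> \<in> Mor1 C"
    and cod2_Mor1: "\<alpha> \<in> Mor2 C \<Longrightarrow> cod2 C \<alpha> \<in> Mor1 C"
    and parallel_dom1: "\<alpha> \<in> Mor2 C \<Longrightarrow> dom1 C (dom2 C \<alpha>) = dom1 C (cod2 C \<alpha>)"
    and parallel_cod1: "\<alpha> \<in> Mor2 C \<Longrightarrow> cod1 C (dom2 C \<alpha>) = cod1 C (cod2 C \<alpha>)"
    and id1_hom1: "X \<in> Obj C \<Longrightarrow> id1 C X \<in> hom1 C X X"
    and comp1_hom1: "\<lbrakk>f \<in> hom1 C X Y; g \<in> hom1 C Y Z\<rbrakk> \<Longrightarrow> g \<cdot> f \<in> hom1 C X Z"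
    and comp1_id1_left: "f \<in> hom1 C X Y \<Longrightarrow> id1 C Y \<cdot> f = f"
    and comp1_id1_right: "f \<in> hom1 C X Y \<Longrightarrow> f \<cdot> id1 C X = f"
    and comp1_assoc: "\<lbrakk>f \<in> hom1 C W X; g \<in> hom1 C X Y; h \<in> hom1 C Y Z\<rbrakk>
      \<Longrightarrow> (h \<cdot> g) \<cdot> f = h \<cdot> (g \<cdot> f)"
    and id2_hom2: "f \<in> Mor1 C \<Longrightarrow> id2 C f \<in> hom2 C f f"
    and vcomp_hom2: "\<lbrakk>\<alpha> \<in> hom2 C f g; \<beta> \<in> hom2 C g h\<rbrakk> \<Longrightarrow> \<beta> \<odot> \<alpha> \<in> hom2 C f h"
    and vcomp_id2_left: "\<alpha> \<in> hom2 C f g \<Longrightarrow> id2 C g \<odot> \<alpha> = \<alpha>"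
    and vcomp_id2_right: "\<alpha> \<in> hom2 C f g \<Longrightarrow> \<alpha> \<odot> id2 C f = \<alpha>"
    and vcomp_assoc: "\<lbrakk>\<alpha> \<in> hom2 C f g; \<beta> \<in> hom2 C g h; \<gamma> \<in> hom2 C h k\<rbrakk>
      \<Longrightarrow> (\<gamma> \<odot> \<beta>) \<odot> \<alpha> = \<gamma> \<odot> (\<beta> \<odot> \<alpha>)"
    and hcomp_hom2: "\<lbrakk>f \<in> hom1 C X Y; g \<in> hom1 C Y Z; \<alpha> \<in> hom2 C f f'; \<beta> \<in> hom2 C g g'\<rbrakk>
      \<Longrightarrow> \<beta> \<star> \<alpha> \<in> hom2 C (g \<cdot> f) (g' \<cdot> f')"
    and hcomp_id_left: "\<lbrakk>f \<in> hom1 C X Y; \<alpha> \<in> hom2 C f f'\<rbrakk> \<Longrightarrow> id2 C (id1 C Y) \<star> \<alpha> = \<alpha>"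
    and hcomp_id_right: "\<lbrakk>f \<in> hom1 C X Y; \<alpha> \<in> hom2 C f f'\<rbrakk> \<Longrightarrow> \<alpha> \<star> id2 C (id1 C X) = \<alpha>"
    and hcomp_assoc: "\<lbrakk>f \<in> hom1 C W X; g \<in> hom1 C X Y; h \<in> hom1 C Y Z;
        \<alpha> \<in> hom2 C f f'; \<beta> \<in> hom2 C g g'; \<gamma> \<in> hom2 C h h'\<rbrakk>
      \<Longrightarrow> (\<gamma> \<star> \<beta>) \<star> \<alpha> = \<gamma> \<star> (\<beta> \<star> \<alpha>)"
    and hcomp_id2: "\<lbrakk>f \<in> hom1 C X Y; g \<in> hom1 C Y Z\<rbrakk> \<Longrightarrow> id2 C g \<star> id2 C f = id2 C (g \<cdot> f)"
    and interchange: "\<lbrakk>f \<in> hom1 C X Y; g \<in> hom1 C Y Z;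
        \<alpha> \<in> hom2 C f f'; \<alpha>' \<in> hom2 C f' f''; \<beta> \<in> hom2 C g g'; \<beta>' \<in> hom2 C g' g''\<rbrakk>
      \<Longrightarrow> (\<beta>' \<odot> \<beta>) \<star> (\<alpha>' \<odot> \<alpha>) = (\<beta>' \<star> \<alpha>') \<odot> (\<beta> \<star> \<alpha>)"

definition whisker_left :: "('o, 'a, 'c, 'z) two_cat_scheme \<Rightarrow> 'a \<Rightarrow> 'c \<Rightarrow> 'c"
    (infixr "\<rhd>\<index>" 74)
  where "f \<rhd>\<^bsub>C\<^esub> \<alpha> = id2 C f \<star>\<^bsub>C\<^esub> \<alpha>"

definition whisker_right :: "('o, 'a, 'c, 'z) two_cat_scheme \<Rightarrow> 'c \<Rightarrow> 'a \<Rightarrow> 'c"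
    (infixl "\<lhd>\<index>" 74)
  where "\<alpha> \<lhd>\<^bsub>C\<^esub> f = \<alpha> \<star>\<^bsub>C\<^esub> id2 C f"

definition inverse2 :: "('o, 'a, 'c, 'z) two_cat_scheme \<Rightarrow> 'c \<Rightarrow> 'c \<Rightarrow> bool"
  where "inverse2 C \<alpha> \<beta> \<longleftrightarrow>
    \<beta> \<in> hom2 C (cod2 C \<alpha>) (dom2 C \<alpha>) \<and>
    \<beta> \<odot>\<^bsub>C\<^esub> \<alpha> = id2 C (dom2 C \<alpha>) \<and> \<alpha> \<odot>\<^bsub>C\<^esub> \<beta> = id2 C (cod2 C \<alpha>)"

definition iso2 :: "('o, 'a, 'c, 'z) two_cat_scheme \<Rightarrow> 'a \<Rightarrow> 'a \<Rightarrow> 'c set"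
  where "iso2 C f g = {\<alpha> \<in> hom2 C f g. \<exists>\<beta>. inverse2 C \<alpha> \<beta>}"

definition inv2 :: "('o, 'a, 'c, 'z) two_cat_scheme \<Rightarrow> 'c \<Rightarrow> 'c"
  where "inv2 C \<alpha> = (THE \<beta>. inverse2 C \<alpha> \<beta>)"


section \<open>Weak 2-products and weak 2-coproducts\<close>

definition weak_2_product ::
    "('o, 'a, 'c, 'z) two_cat_scheme \<Rightarrow> 'o \<Rightarrow> 'o \<Rightarrow> 'o \<Rightarrow> 'a \<Rightarrow> 'a \<Rightarrow> bool"
  where "weak_2_product C A B P pA pB \<longleftrightarrow>
    P \<in> Obj C \<and> pA \<in> hom1 C P A \<and> pB \<in> hom1 C P B \<and>
    (\<forall>X \<in> Obj C. \<forall>f \<in> hom1 C X A. \<forall>g \<in> hom1 C X B.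
      \<exists>b \<in> hom1 C X P. iso2 C (pA \<cdot> b) f \<noteq> {} \<and> iso2 C (pB \<cdot> b) g \<noteq> {}) \<and>
    (\<forall>X \<in> Obj C.
      \<forall>f \<in> hom1 C X A. \<forall>g \<in> hom1 C X B.
      \<forall>b \<in> hom1 C X P. \<forall>\<xi>A \<in> iso2 C (pA \<cdot> b) f. \<forall>\<xi>B \<in> iso2 C (pB \<cdot> b) g.
      \<forall>f' \<in> hom1 C X A. \<forall>g' \<in> hom1 C X B.
      \<forall>b' \<in> hom1 C X P. \<forall>\<xi>A' \<in> iso2 C (pA \<cdot> b') f'. \<forall>\<xi>B' \<in> iso2 C (pB \<cdot> b') g'.
      \<forall>\<Sigma>A \<in> hom2 C f f'. \<forall>\<Sigma>B \<in> hom2 C g g'.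
      \<exists>!\<gamma>. \<gamma> \<in> hom2 C b b' \<and>
        pA \<rhd> \<gamma> = inv2 C \<xi>A' \<odot> \<Sigma>A \<odot> \<xi>A \<and>
        pB \<rhd> \<gamma> = inv2 C \<xi>B' \<odot> \<Sigma>B \<odot> \<xi>B)"
  for C (structure)

definition weak_2_coproduct ::
    "('o, 'a, 'c, 'z) two_cat_scheme \<Rightarrow> 'o \<Rightarrow> 'o \<Rightarrow> 'o \<Rightarrow> 'a \<Rightarrow> 'a \<Rightarrow> bool"
  where "weak_2_coproduct C A B U iA iB \<longleftrightarrow>
    U \<in> Obj C \<and> iA \<in> hom1 C A U \<and> iB \<in> hom1 C B U \<and>
    (\<forall>X \<in> Obj C. \<forall>f \<in> hom1 C A X. \<forall>g \<in> hom1 C B X.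
      \<exists>b \<in> hom1 C U X. iso2 C (b \<cdot> iA) f \<noteq> {} \<and> iso2 C (b \<cdot> iB) g \<noteq> {}) \<and>
    (\<forall>X \<in> Obj C.
      \<forall>f \<in> hom1 C A X. \<forall>g \<in> hom1 C B X.
      \<forall>b \<in> hom1 C U X. \<forall>\<xi>A \<in> iso2 C (b \<cdot> iA) f. \<forall>\<xi>B \<in> iso2 C (b \<cdot> iB) g.
      \<forall>f' \<in> hom1 C A X. \<forall>g' \<in> hom1 C B X.
      \<forall>b' \<in> hom1 C U X. \<forall>\<xi>A' \<in> iso2 C (b' \<cdot> iA) f'. \<forall>\<xi>B' \<in> iso2 C (b' \<cdot> iB) g'.
      \<forall>\<Sigma>A \<in> hom2 C f f'. \<forall>\<Sigma>B \<in> hom2 C g g'.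
      \<exists>!\<gamma>. \<gamma> \<in> hom2 C b b' \<and>
        \<gamma> \<lhd> iA = inv2 C \<xi>A' \<odot> \<Sigma>A \<odot> \<xi>A \<and>
        \<gamma> \<lhd> iB = inv2 C \<xi>B' \<odot> \<Sigma>B \<odot> \<xi>B)"
  for C (structure)


section \<open>Equivalences\<close>

definition is_equivalence :: "('o, 'a, 'c, 'z) two_cat_scheme \<Rightarrow> 'o \<Rightarrow> 'o \<Rightarrow> 'a \<Rightarrow> bool"
  where "is_equivalence C U P r \<longleftrightarrow> r \<in> hom1 C U P \<and>
    (\<exists>r' \<in> hom1 C P U. \<exists>\<xi>P \<in> iso2 C (r \<cdot> r') (id1 C P). \<exists>\<xi>U \<in> iso2 C (id1 C U) (r' \<cdot> r).
      (r' \<rhd> \<xi>P) \<odot> (\<xi>U \<lhd> r') = id2 C r' \<and>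
      (\<xi>P \<lhd> r) \<odot> (r \<rhd> \<xi>U) = id2 C r)"
  for C (structure)


section \<open>Local semiadditivity and compositional distributivity\<close>

definition is_zero_object :: "('o, 'a, 'c, 'z) two_cat_scheme \<Rightarrow> 'o \<Rightarrow> 'o \<Rightarrow> 'a \<Rightarrow> bool"
  where "is_zero_object C X Y z \<longleftrightarrow> z \<in> hom1 C X Y \<and>
    (\<forall>f \<in> hom1 C X Y. (\<exists>!\<alpha>. \<alpha> \<in> hom2 C z f) \<and> (\<exists>!\<alpha>. \<alpha> \<in> hom2 C f z))"

definition is_zero_morphism2 :: "('o, 'a, 'c, 'z) two_cat_scheme \<Rightarrow> 'a \<Rightarrow> 'a \<Rightarrow> 'c \<Rightarrow> bool"
  where "is_zero_morphism2 C f g \<alpha> \<longleftrightarrow>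
    (\<exists>z. is_zero_object C (dom1 C f) (cod1 C f) z \<and>
      (\<exists>\<beta> \<in> hom2 C f z. \<exists>\<gamma> \<in> hom2 C z g. \<alpha> = \<gamma> \<odot>\<^bsub>C\<^esub> \<beta>))"

definition is_biproduct ::
    "('o, 'a, 'c, 'z) two_cat_scheme \<Rightarrow> 'a \<Rightarrow> 'a \<Rightarrow> 'a \<Rightarrow> 'c \<Rightarrow> 'c \<Rightarrow> 'c \<Rightarrow> 'c \<Rightarrow> bool"
  where "is_biproduct C f g s \<pi>1 \<pi>2 \<nu>1 \<nu>2 \<longleftrightarrow>
    s \<in> hom1 C (dom1 C f) (cod1 C f) \<and>
    \<pi>1 \<in> hom2 C s f \<and> \<pi>2 \<in> hom2 C s g \<and> \<nu>1 \<in> hom2 C f s \<and> \<nu>2 \<in> hom2 C g s \<and>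
    (\<forall>h \<in> hom1 C (dom1 C f) (cod1 C f). \<forall>\<alpha> \<in> hom2 C h f. \<forall>\<beta> \<in> hom2 C h g.
      \<exists>!\<gamma>. \<gamma> \<in> hom2 C h s \<and> \<pi>1 \<odot> \<gamma> = \<alpha> \<and> \<pi>2 \<odot> \<gamma> = \<beta>) \<and>
    (\<forall>h \<in> hom1 C (dom1 C f) (cod1 C f). \<forall>\<alpha> \<in> hom2 C f h. \<forall>\<beta> \<in> hom2 C g h.
      \<exists>!\<gamma>. \<gamma> \<in> hom2 C s h \<and> \<gamma> \<odot> \<nu>1 = \<alpha> \<and> \<gamma> \<odot> \<nu>2 = \<beta>) \<and>
    \<pi>1 \<odot> \<nu>1 = id2 C f \<and> \<pi>2 \<odot> \<nu>2 = id2 C g \<and>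
    is_zero_morphism2 C g f (\<pi>1 \<odot> \<nu>2) \<and> is_zero_morphism2 C f g (\<pi>2 \<odot> \<nu>1)"
  for C (structure)

text \<open>
  The notations for zero objects and biproducts in the Hom-categories presuppose a choice
  of these data.  The choice is part of the structure and is otherwise arbitrary.
  \<^term>\<open>zero1 C Y X\<close> is the zero 1-morphism from X to Y (note the order).
\<close>

record ('o, 'a, 'c) semiadditive_two_cat = "('o, 'a, 'c) two_cat" +
  zero1 :: "'o \<Rightarrow> 'o \<Rightarrow> 'a"
  oplus1 :: "'a \<Rightarrow> 'a \<Rightarrow> 'a"  (infixl "\<oplus>\<index>" 65)
  proj1 :: "'a \<Rightarrow> 'a \<Rightarrow> 'c"
  proj2 :: "'a \<Rightarrow> 'a \<Rightarrow> 'c"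
  inj1 :: "'a \<Rightarrow> 'a \<Rightarrow> 'c"
  inj2 :: "'a \<Rightarrow> 'a \<Rightarrow> 'c"

definition locally_semiadditive :: "('o, 'a, 'c, 'z) semiadditive_two_cat_scheme \<Rightarrow> bool"
  where "locally_semiadditive C \<longleftrightarrow>
    (\<forall>X \<in> Obj C. \<forall>Y \<in> Obj C. is_zero_object C X Y (zero1 C Y X)) \<and>
    (\<forall>X \<in> Obj C. \<forall>Y \<in> Obj C. \<forall>f \<in> hom1 C X Y. \<forall>g \<in> hom1 C X Y.
      is_biproduct C f g (f \<oplus>\<^bsub>C\<^esub> g) (proj1 C f g) (proj2 C f g) (inj1 C f g) (inj2 C f g))"

text \<open>
  The sum of \<open>\<alpha>, \<beta> : f \<Rightarrow> g\<close> is the composite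
  \<open>f \<Rightarrow> g \<oplus> g \<Rightarrow> g\<close> of the 2-morphism with components \<open>\<alpha>, \<beta>\<close> and the codiagonal.
\<close>

definition pair2 :: "('o, 'a, 'c, 'z) semiadditive_two_cat_scheme \<Rightarrow> 'c \<Rightarrow> 'c \<Rightarrow> 'c"
  where "pair2 C \<alpha> \<beta> = (THE \<gamma>. \<gamma> \<in> hom2 C (dom2 C \<alpha>) (cod2 C \<alpha> \<oplus>\<^bsub>C\<^esub> cod2 C \<beta>) \<and>
    proj1 C (cod2 C \<alpha>) (cod2 C \<beta>) \<odot>\<^bsub>C\<^esub> \<gamma> = \<alpha> \<and>
    proj2 C (cod2 C \<alpha>) (cod2 C \<beta>) \<odot>\<^bsub>C\<^esub> \<gamma> = \<beta>)"

definition codiag2 :: "('o, 'a, 'c, 'z) semiadditive_two_cat_scheme \<Rightarrow> 'a \<Rightarrow> 'c"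
  where "codiag2 C g = (THE \<gamma>. \<gamma> \<in> hom2 C (g \<oplus>\<^bsub>C\<^esub> g) g \<and>
    \<gamma> \<odot>\<^bsub>C\<^esub> inj1 C g g = id2 C g \<and> \<gamma> \<odot>\<^bsub>C\<^esub> inj2 C g g = id2 C g)"

definition add2 :: "('o, 'a, 'c, 'z) semiadditive_two_cat_scheme \<Rightarrow> 'c \<Rightarrow> 'c \<Rightarrow> 'c"
    (infixl "\<boxplus>\<index>" 65)
  where "\<alpha> \<boxplus>\<^bsub>C\<^esub> \<beta> = codiag2 C (cod2 C \<alpha>) \<odot>\<^bsub>C\<^esub> pair2 C \<alpha> \<beta>"

definition compositionally_distributive ::
    "('o, 'a, 'c, 'z) semiadditive_two_cat_scheme \<Rightarrow> bool"
  where "compositionally_distributive C \<longleftrightarrow>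
    (\<forall>X \<in> Obj C. \<forall>Y \<in> Obj C. \<forall>Z \<in> Obj C.
      \<forall>f \<in> hom1 C X Y. \<forall>f' \<in> hom1 C X Y. \<forall>g \<in> hom1 C Y Z. \<forall>g' \<in> hom1 C Y Z.
      \<forall>\<alpha> \<in> hom2 C f f'. \<forall>\<beta> \<in> hom2 C f f'. \<forall>\<gamma> \<in> hom2 C g g'.
        \<gamma> \<star> (\<alpha> \<boxplus> \<beta>) = (\<gamma> \<star> \<alpha>) \<boxplus> (\<gamma> \<star> \<beta>)) \<and>
    (\<forall>X \<in> Obj C. \<forall>Y \<in> Obj C. \<forall>Z \<in> Obj C.
      \<forall>f \<in> hom1 C X Y. \<forall>f' \<in> hom1 C X Y. \<forall>g \<in> hom1 C Y Z. \<forall>g' \<in> hom1 C Y Z.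
      \<forall>\<alpha> \<in> hom2 C g g'. \<forall>\<beta> \<in> hom2 C g g'. \<forall>\<gamma> \<in> hom2 C f f'.
        (\<alpha> \<boxplus> \<beta>) \<star> \<gamma> = (\<alpha> \<star> \<gamma>) \<boxplus> (\<beta> \<star> \<gamma>)) \<and>
    (\<forall>X \<in> Obj C. \<forall>Y \<in> Obj C. \<forall>f \<in> hom1 C X Y. \<forall>g \<in> hom1 C X Y. \<forall>h \<in> hom1 C X Y.
      \<forall>\<beta> \<in> hom2 C f g. \<forall>\<gamma> \<in> hom2 C f g. \<forall>\<alpha> \<in> hom2 C g h.
        \<alpha> \<odot> (\<beta> \<boxplus> \<gamma>) = (\<alpha> \<odot> \<beta>) \<boxplus> (\<alpha> \<odot> \<gamma>))"
  for C (structure)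


section \<open>Canonical 1-morphisms and weak 2-biproducts\<close>

definition canonical_1_morphism ::
    "('o, 'a, 'c, 'z) semiadditive_two_cat_scheme \<Rightarrow> 'o \<Rightarrow> 'o \<Rightarrow>
      'o \<Rightarrow> 'a \<Rightarrow> 'a \<Rightarrow> 'o \<Rightarrow> 'a \<Rightarrow> 'a \<Rightarrow> 'a \<Rightarrow> bool"
  where "canonical_1_morphism C A B U iA iB P pA pB r \<longleftrightarrow> r \<in> hom1 C U P \<and>
    iso2 C (pA \<cdot> r \<cdot> iA) (id1 C A) \<noteq> {} \<and>
    iso2 C (pB \<cdot> r \<cdot> iB) (id1 C B) \<noteq> {} \<and>
    iso2 C (pA \<cdot> r \<cdot> iB) (zero1 C A B) \<noteq> {} \<and>
    iso2 C (pB \<cdot> r \<cdot> iA) (zero1 C B A) \<noteq> {}"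
  for C (structure)

text \<open>
  The last two conditions are the two matrix equations.  With respect to the
  decompositions of source and target, the only nonzero entry of the first matrix is
  \<open>(p\<^sub>A j\<^sub>A)\<theta>\<^sub>A\<close>, at the component \<open>p\<^sub>A j\<^sub>A p\<^sub>A j\<^sub>A\<close> of the source; so the matrix is this
  entry composed with the whiskered projection onto that component.
\<close>

definition weak_2_biproduct ::
    "('o, 'a, 'c, 'z) semiadditive_two_cat_scheme \<Rightarrow> 'o \<Rightarrow> 'o \<Rightarrow>
      'o \<Rightarrow> 'a \<Rightarrow> 'a \<Rightarrow> 'a \<Rightarrow> 'a \<Rightarrow> 'c \<Rightarrow> 'c \<Rightarrow> 'c \<Rightarrow> 'c \<Rightarrow> 'c \<Rightarrow> bool"
  where "weak_2_biproduct C A B P pA pB jA jB \<theta>A \<theta>B \<theta>AB \<theta>BA \<theta>P \<longleftrightarrow>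
    P \<in> Obj C \<and>
    pA \<in> hom1 C P A \<and> pB \<in> hom1 C P B \<and> jA \<in> hom1 C A P \<and> jB \<in> hom1 C B P \<and>
    \<theta>A \<in> iso2 C (pA \<cdot> jA) (id1 C A) \<and>
    \<theta>B \<in> iso2 C (pB \<cdot> jB) (id1 C B) \<and>
    \<theta>BA \<in> iso2 C (pB \<cdot> jA) (zero1 C B A) \<and>
    \<theta>AB \<in> iso2 C (pA \<cdot> jB) (zero1 C A B) \<and>
    \<theta>P \<in> iso2 C (jA \<cdot> pA \<oplus> jB \<cdot> pB) (id1 C P) \<and>
    pA \<rhd> (\<theta>P \<lhd> jA) = ((pA \<cdot> jA) \<rhd> \<theta>A) \<odot> (pA \<rhd> (proj1 C (jA \<cdot> pA) (jB \<cdot> pB) \<lhd> jA)) \<and>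
    pB \<rhd> (\<theta>P \<lhd> jB) = ((pB \<cdot> jB) \<rhd> \<theta>B) \<odot> (pB \<rhd> (proj2 C (jA \<cdot> pA) (jB \<cdot> pB) \<lhd> jB))"
  for C (structure)

end

theory Submission
  imports Defs
begin

text \<open>
  A canonical 1-morphism is always an equivalence, and the 2-isomorphisms of a weak 2-biproduct
  always exist, so both sides of the claim hold.  Distributivity does not say that composition
  preserves zero 1-morphisms.  But if \<open>U\<close> is a weak 2-coproduct and \<open>s : U \<rightarrow> Z\<close>, the
  2-endomorphism of \<open>s\<close> with components \<open>0\<close> on \<open>A\<close> and \<open>1\<close> on \<open>B\<close> shows that \<open>s\<close> annihilates the
  zero 1-morphisms from \<open>A\<close> (and likewise from \<open>B\<close>).  With \<open>r\<close> it follows that all 1-morphisms out of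
  \<open>A\<close> or \<open>B\<close> annihilate the zero 1-morphisms among \<open>A\<close> and \<open>B\<close>, and dually.  Hence
  \<open>pA (r iA pA \<oplus> r iB pB) \<cong> pA\<close> and the same for \<open>pB\<close>, which the weak 2-product lifts to \<open>\<theta>P\<close>; the
  quasi-inverse of \<open>r\<close> is \<open>iA pA \<oplus> iB pB\<close>.
\<close>

section \<open>Composition and whiskering in a strict 2-category\<close>

context two_category
begin

text \<open>Here and in the rules that follow, typing is expressed by equations between domains and
  codomains. The axioms use hom-sets with free object variables; in equational form, composability
  can be checked by rewriting alone.\<close>

lemma comp1_arr [simp]:
  assumes "f \<in> Mor1 C" "g \<in> Mor1 C" "dom1 C g = cod1 C f"
  shows "g \<cdot> f \<in> Mor1 C" "dom1 C (g \<cdot> f) = dom1 C f" "cod1 C (g \<cdot> f) = cod1 C g"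
  using comp1_hom1[of f "dom1 C f" "cod1 C f" g "cod1 C g"] assms by (auto simp: hom1_def)

lemma id1_arr [simp]:
  assumes "X \<in> Obj C"
  shows "id1 C X \<in> Mor1 C" "dom1 C (id1 C X) = X" "cod1 C (id1 C X) = X"
  using id1_hom1[OF assms] by (auto simp: hom1_def)

lemma comp1_unit [simp]:
  assumes "f \<in> Mor1 C"
  shows "cod1 C f = Y \<Longrightarrow> id1 C Y \<cdot> f = f" "dom1 C f = X \<Longrightarrow> f \<cdot> id1 C X = f"
  using comp1_id1_left[of f "dom1 C f" Y] comp1_id1_right[of f X "cod1 C f"] assms
  by (auto simp: hom1_def)

lemma comp1_assoc' [simp]:
  assumes "f \<in> Mor1 C" "g \<in> Mor1 C" "h \<in> Mor1 C" "dom1 C g = cod1 C f" "dom1 C h = cod1 C g"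
  shows "(h \<cdot> g) \<cdot> f = h \<cdot> (g \<cdot> f)"
  using comp1_assoc[of f "dom1 C f" "cod1 C f" g "cod1 C g" h "cod1 C h"] assms
  by (auto simp: hom1_def)

lemma id2_arr [simp]:
  assumes "f \<in> Mor1 C"
  shows "id2 C f \<in> Mor2 C" "dom2 C (id2 C f) = f" "cod2 C (id2 C f) = f"
  using id2_hom2[OF assms] by (auto simp: hom2_def)

lemma vcomp_arr [simp]:
  assumes "\<alpha> \<in> Mor2 C" "\<beta> \<in> Mor2 C" "dom2 C \<beta> = cod2 C \<alpha>"
  shows "\<beta> \<odot> \<alpha> \<in> Mor2 C" "dom2 C (\<beta> \<odot> \<alpha>) = dom2 C \<alpha>" "cod2 C (\<beta> \<odot> \<alpha>) = cod2 C \<beta>"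
  using vcomp_hom2[of \<alpha> "dom2 C \<alpha>" "cod2 C \<alpha>" \<beta> "cod2 C \<beta>"] assms by (auto simp: hom2_def)

lemma vcomp_unit [simp]:
  assumes "\<alpha> \<in> Mor2 C"
  shows "cod2 C \<alpha> = g \<Longrightarrow> id2 C g \<odot> \<alpha> = \<alpha>" "dom2 C \<alpha> = f \<Longrightarrow> \<alpha> \<odot> id2 C f = \<alpha>"
  using vcomp_id2_left[of \<alpha> "dom2 C \<alpha>" g] vcomp_id2_right[of \<alpha> f "cod2 C \<alpha>"] assms
  by (auto simp: hom2_def)

lemma vcomp_assoc' [simp]:
  assumes "\<alpha> \<in> Mor2 C" "\<beta> \<in> Mor2 C" "\<gamma> \<in> Mor2 C" "dom2 C \<beta> = cod2 C \<alpha>" "dom2 C \<gamma> = cod2 C \<beta>"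
  shows "(\<gamma> \<odot> \<beta>) \<odot> \<alpha> = \<gamma> \<odot> (\<beta> \<odot> \<alpha>)"
  using vcomp_assoc[of \<alpha> "dom2 C \<alpha>" "cod2 C \<alpha>" \<beta> "cod2 C \<beta>" \<gamma> "cod2 C \<gamma>"] assms
  by (auto simp: hom2_def)

lemma hcomp_arr [simp]:
  assumes "\<alpha> \<in> Mor2 C" "\<beta> \<in> Mor2 C" "dom1 C (dom2 C \<beta>) = cod1 C (dom2 C \<alpha>)"
  shows "\<beta> \<star> \<alpha> \<in> Mor2 C" "dom2 C (\<beta> \<star> \<alpha>) = dom2 C \<beta> \<cdot> dom2 C \<alpha>"
    "cod2 C (\<beta> \<star> \<alpha>) = cod2 C \<beta> \<cdot> cod2 C \<alpha>"
  using hcomp_hom2[of "dom2 C \<alpha>" "dom1 C (dom2 C \<alpha>)" "cod1 C (dom2 C \<alpha>)"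
      "dom2 C \<beta>" "cod1 C (dom2 C \<beta>)" \<alpha> "cod2 C \<alpha>" \<beta> "cod2 C \<beta>"] assms
  by (auto simp: hom1_def hom2_def dom2_Mor1)

text \<open>Oriented from right to left compared with the axiom: two vertically composed horizontal
  composites merge into one, which is the direction in which whiskerings are compared.\<close>

lemma interchange':
  assumes "\<alpha> \<in> Mor2 C" "\<beta> \<in> Mor2 C" "\<alpha>' \<in> Mor2 C" "\<beta>' \<in> Mor2 C"
    "dom2 C \<alpha>' = cod2 C \<alpha>" "dom2 C \<beta>' = cod2 C \<beta>"
    "dom1 C (dom2 C \<beta>) = cod1 C (dom2 C \<alpha>)"
  shows "(\<beta>' \<star> \<alpha>') \<odot> (\<beta> \<star> \<alpha>) = (\<beta>' \<odot> \<beta>) \<star> (\<alpha>' \<odot> \<alpha>)"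
  using interchange[of "dom2 C \<alpha>" "dom1 C (dom2 C \<alpha>)" "cod1 C (dom2 C \<alpha>)"
      "dom2 C \<beta>" "cod1 C (dom2 C \<beta>)" \<alpha> "cod2 C \<alpha>" \<alpha>' "cod2 C \<alpha>'" \<beta> "cod2 C \<beta>" \<beta>' "cod2 C \<beta>'"] assms
  by (auto simp: hom1_def hom2_def dom2_Mor1)

lemma hcomp_assoc':
  assumes "\<alpha> \<in> Mor2 C" "\<beta> \<in> Mor2 C" "\<gamma> \<in> Mor2 C"
    "dom1 C (dom2 C \<beta>) = cod1 C (dom2 C \<alpha>)" "dom1 C (dom2 C \<gamma>) = cod1 C (dom2 C \<beta>)"
  shows "(\<gamma> \<star> \<beta>) \<star> \<alpha> = \<gamma> \<star> (\<beta> \<star> \<alpha>)"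
  using hcomp_assoc[of "dom2 C \<alpha>" "dom1 C (dom2 C \<alpha>)" "cod1 C (dom2 C \<alpha>)"
      "dom2 C \<beta>" "cod1 C (dom2 C \<beta>)" "dom2 C \<gamma>" "cod1 C (dom2 C \<gamma>)"
      \<alpha> "cod2 C \<alpha>" \<beta> "cod2 C \<beta>" \<gamma> "cod2 C \<gamma>"] assms
  by (auto simp: hom1_def hom2_def dom2_Mor1)

lemma hcomp_id2':
  assumes "f \<in> Mor1 C" "g \<in> Mor1 C" "dom1 C g = cod1 C f"
  shows "id2 C g \<star> id2 C f = id2 C (g \<cdot> f)"
  using hcomp_id2[of f "dom1 C f" "cod1 C f" g "cod1 C g"] assms by (auto simp: hom1_def)

lemma whisker_left_arr [simp]:
  assumes "f \<in> Mor1 C" "\<alpha> \<in> Mor2 C" "dom1 C f = cod1 C (dom2 C \<alpha>)"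
  shows "f \<rhd> \<alpha> \<in> Mor2 C" "dom2 C (f \<rhd> \<alpha>) = f \<cdot> dom2 C \<alpha>" "cod2 C (f \<rhd> \<alpha>) = f \<cdot> cod2 C \<alpha>"
  using assms by (auto simp: whisker_left_def)

lemma whisker_right_arr [simp]:
  assumes "f \<in> Mor1 C" "\<alpha> \<in> Mor2 C" "dom1 C (dom2 C \<alpha>) = cod1 C f"
  shows "\<alpha> \<lhd> f \<in> Mor2 C" "dom2 C (\<alpha> \<lhd> f) = dom2 C \<alpha> \<cdot> f" "cod2 C (\<alpha> \<lhd> f) = cod2 C \<alpha> \<cdot> f"
  using assms by (auto simp: whisker_right_def)

lemma whisker_left_vcomp:
  assumes "f \<in> Mor1 C" "\<alpha> \<in> Mor2 C" "\<beta> \<in> Mor2 C" "dom2 C \<beta> = cod2 C \<alpha>"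
    "dom1 C f = cod1 C (dom2 C \<alpha>)"
  shows "f \<rhd> (\<beta> \<odot> \<alpha>) = (f \<rhd> \<beta>) \<odot> (f \<rhd> \<alpha>)"
  using assms interchange'[of \<alpha> "id2 C f" \<beta> "id2 C f"] by (simp add: whisker_left_def)

lemma whisker_right_vcomp:
  assumes "f \<in> Mor1 C" "\<alpha> \<in> Mor2 C" "\<beta> \<in> Mor2 C" "dom2 C \<beta> = cod2 C \<alpha>"
    "dom1 C (dom2 C \<alpha>) = cod1 C f"
  shows "(\<beta> \<odot> \<alpha>) \<lhd> f = (\<beta> \<lhd> f) \<odot> (\<alpha> \<lhd> f)"
  using assms interchange'[of "id2 C f" \<alpha> "id2 C f" \<beta>] by (simp add: whisker_right_def)

lemma whisker_id2 [simp]: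
  assumes "f \<in> Mor1 C" "g \<in> Mor1 C" "dom1 C g = cod1 C f"
  shows "g \<rhd> id2 C f = id2 C (g \<cdot> f)" "id2 C g \<lhd> f = id2 C (g \<cdot> f)"
  using hcomp_id2'[OF assms] by (simp_all add: whisker_left_def whisker_right_def)

lemma whisker_left_left [simp]:
  assumes "f \<in> Mor1 C" "g \<in> Mor1 C" "\<alpha> \<in> Mor2 C" "dom1 C f = cod1 C (dom2 C \<alpha>)"
    "dom1 C g = cod1 C f"
  shows "g \<rhd> f \<rhd> \<alpha> = (g \<cdot> f) \<rhd> \<alpha>"
  using assms hcomp_assoc'[of \<alpha> "id2 C f" "id2 C g"]
  by (simp add: whisker_left_def hcomp_id2')

lemma whisker_right_right [simp]:
  assumes "f \<in> Mor1 C" "g \<in> Mor1 C" "\<alpha> \<in> Mor2 C" "dom1 C (dom2 C \<alpha>) = cod1 C g"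
    "dom1 C g = cod1 C f"
  shows "\<alpha> \<lhd> g \<lhd> f = \<alpha> \<lhd> (g \<cdot> f)"
  using assms hcomp_assoc'[of "id2 C f" "id2 C g" \<alpha>]
  by (simp add: whisker_right_def hcomp_id2')

text \<open>With the two preceding rules this gives a normal form for iterated whiskering:
  \<open>g \<rhd> (\<alpha> \<lhd> f)\<close> with a single 1-morphism on each side.\<close>

lemma whisker_left_right [simp]:
  assumes "f \<in> Mor1 C" "g \<in> Mor1 C" "\<alpha> \<in> Mor2 C" "dom1 C (dom2 C \<alpha>) = cod1 C f"
    "dom1 C g = cod1 C (dom2 C \<alpha>)"
  shows "(g \<rhd> \<alpha>) \<lhd> f = g \<rhd> (\<alpha> \<lhd> f)"
  using assms hcomp_assoc'[of "id2 C f" \<alpha> "id2 C g"]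
  by (simp add: whisker_right_def whisker_left_def)

lemma whisker_id1 [simp]:
  assumes "\<alpha> \<in> Mor2 C"
  shows "cod1 C (dom2 C \<alpha>) = Y \<Longrightarrow> id1 C Y \<rhd> \<alpha> = \<alpha>"
    "dom1 C (dom2 C \<alpha>) = X \<Longrightarrow> \<alpha> \<lhd> id1 C X = \<alpha>"
  using assms hcomp_id_left[of "dom2 C \<alpha>" "dom1 C (dom2 C \<alpha>)" Y \<alpha> "cod2 C \<alpha>"]
    hcomp_id_right[of "dom2 C \<alpha>" X "cod1 C (dom2 C \<alpha>)" \<alpha> "cod2 C \<alpha>"]
  by (auto simp: hom1_def hom2_def dom2_Mor1 whisker_left_def whisker_right_def)

text \<open>By interchange, both sides are the horizontal composite
  \<open>\<beta> \<star> \<alpha>\<close>.\<close>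

lemma whisker_exchange:
  assumes "\<alpha> \<in> hom2 C f f'" "\<beta> \<in> hom2 C g g'" "dom1 C g = cod1 C f"
  shows "(\<beta> \<lhd> f') \<odot> (g \<rhd> \<alpha>) = (g' \<rhd> \<alpha>) \<odot> (\<beta> \<lhd> f)"
proof -
  have [simp]: "\<alpha> \<in> Mor2 C" "dom2 C \<alpha> = f" "cod2 C \<alpha> = f'" "\<beta> \<in> Mor2 C" "dom2 C \<beta> = g" "cod2 C \<beta> = g'"
    using assms by (auto simp: hom2_def)
  have [simp]: "f \<in> Mor1 C" "f' \<in> Mor1 C" "g \<in> Mor1 C" "g' \<in> Mor1 C"
    using dom2_Mor1[of \<alpha>] dom2_Mor1[of \<beta>] cod2_Mor1[of \<alpha>] cod2_Mor1[of \<beta>] by auto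
  show ?thesis using assms(3)
    by (simp add: whisker_left_def whisker_right_def interchange')
qed


lemma hom2_parallel:
  assumes "\<alpha> \<in> hom2 C f g" "f \<in> hom1 C X Y"
  shows "g \<in> hom1 C X Y"
  using assms parallel_dom1[of \<alpha>] parallel_cod1[of \<alpha>] cod2_Mor1[of \<alpha>] by (auto simp: hom1_def hom2_def)

lemma hom2_parallel':
  assumes "\<alpha> \<in> hom2 C f g" "g \<in> hom1 C X Y"
  shows "f \<in> hom1 C X Y"
  using assms parallel_dom1[of \<alpha>] parallel_cod1[of \<alpha>] dom2_Mor1[of \<alpha>] by (auto simp: hom1_def hom2_def)

lemma hom1_Obj:
  assumes "f \<in> hom1 C X Y"
  shows "X \<in> Obj C" "Y \<in> Obj C"
  using assms dom1_Obj cod1_Obj by (auto simp: hom1_def)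

lemma whisker_left_hom2:
  assumes "h \<in> hom1 C Y Z" "f \<in> hom1 C X Y" "\<alpha> \<in> hom2 C f g"
  shows "h \<rhd> \<alpha> \<in> hom2 C (h \<cdot> f) (h \<cdot> g)"
  using assms by (auto simp: hom1_def hom2_def)

subsection \<open>Invertible 2-morphisms\<close>

lemma iso2I:
  assumes "\<alpha> \<in> hom2 C f g" "\<beta> \<in> hom2 C g f" "\<beta> \<odot> \<alpha> = id2 C f" "\<alpha> \<odot> \<beta> = id2 C g"
  shows "\<alpha> \<in> iso2 C f g"
  using assms by (auto simp: iso2_def inverse2_def hom2_def)

lemma iso2E:
  assumes "\<alpha> \<in> iso2 C f g"
  obtains \<beta> where "\<alpha> \<in> hom2 C f g" "\<beta> \<in> hom2 C g f" "\<beta> \<odot> \<alpha> = id2 C f" "\<alpha> \<odot> \<beta> = id2 C g"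
    "\<beta> \<in> iso2 C g f"
  using assms by (auto simp: iso2_def inverse2_def hom2_def)

lemma iso2_hom2: "\<alpha> \<in> iso2 C f g \<Longrightarrow> \<alpha> \<in> hom2 C f g"
  by (simp add: iso2_def)

lemma id2_iso2: "f \<in> Mor1 C \<Longrightarrow> id2 C f \<in> iso2 C f f"
  by (rule iso2I[where \<beta> = "id2 C f"]) (simp_all add: hom2_def)

lemma inv2_id2: "f \<in> Mor1 C \<Longrightarrow> inv2 C (id2 C f) = id2 C f"
  unfolding inv2_def by (rule the_equality) (auto simp: inverse2_def hom2_def)

lemma iso2_vcomp:
  assumes "\<alpha> \<in> iso2 C f g" "\<beta> \<in> iso2 C g h"
  shows "\<beta> \<odot> \<alpha> \<in> iso2 C f h"
proof -
  obtain \<alpha>' where a: "\<alpha> \<in> hom2 C f g" "\<alpha>' \<in> hom2 C g f" "\<alpha>' \<odot> \<alpha> = id2 C f" "\<alpha> \<odot> \<alpha>' = id2 C g"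
    using assms(1) by (rule iso2E)
  obtain \<beta>' where b: "\<beta> \<in> hom2 C g h" "\<beta>' \<in> hom2 C h g" "\<beta>' \<odot> \<beta> = id2 C g" "\<beta> \<odot> \<beta>' = id2 C h"
    using assms(2) by (rule iso2E)
  have "(\<alpha>' \<odot> \<beta>') \<odot> (\<beta> \<odot> \<alpha>) = \<alpha>' \<odot> ((\<beta>' \<odot> \<beta>) \<odot> \<alpha>)"
    using a(1,2) b(1,2) by (simp add: hom2_def)
  moreover have "(\<beta> \<odot> \<alpha>) \<odot> (\<alpha>' \<odot> \<beta>') = \<beta> \<odot> ((\<alpha> \<odot> \<alpha>') \<odot> \<beta>')"
    using a(1,2) b(1,2) by (simp add: hom2_def)
  ultimately show ?thesis using a b
    by (intro iso2I[where \<beta> = "\<alpha>' \<odot> \<beta>'"] vcomp_hom2) (auto simp: hom2_def)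
qed

lemma iso2_whisker_left:
  assumes "h \<in> hom1 C Y Z" "f \<in> hom1 C X Y" "\<alpha> \<in> iso2 C f g"
  shows "h \<rhd> \<alpha> \<in> iso2 C (h \<cdot> f) (h \<cdot> g)"
proof -
  obtain \<beta> where a: "\<alpha> \<in> hom2 C f g" "\<beta> \<in> hom2 C g f" "\<beta> \<odot> \<alpha> = id2 C f" "\<alpha> \<odot> \<beta> = id2 C g"
    using assms(3) by (rule iso2E)
  have g: "g \<in> hom1 C X Y" using a(1) assms(2) by (rule hom2_parallel)
  show ?thesis using assms(1,2) g a
    by (intro iso2I[where \<beta> = "h \<rhd> \<beta>"])
      (simp_all add: hom1_def hom2_def flip: whisker_left_vcomp)
qed

lemma iso2_whisker_right:
  assumes "h \<in> hom1 C W X" "f \<in> hom1 C X Y" "\<alpha> \<in> iso2 C f g"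
  shows "\<alpha> \<lhd> h \<in> iso2 C (f \<cdot> h) (g \<cdot> h)"
proof -
  obtain \<beta> where a: "\<alpha> \<in> hom2 C f g" "\<beta> \<in> hom2 C g f" "\<beta> \<odot> \<alpha> = id2 C f" "\<alpha> \<odot> \<beta> = id2 C g"
    using assms(3) by (rule iso2E)
  have g: "g \<in> hom1 C X Y" using a(1) assms(2) by (rule hom2_parallel)
  show ?thesis using assms(1,2) g a
    by (intro iso2I[where \<beta> = "\<beta> \<lhd> h"])
      (simp_all add: hom1_def hom2_def flip: whisker_right_vcomp)
qed

lemma iso2_cancel_left:
  assumes "\<alpha> \<in> iso2 C g h" "\<beta> \<in> hom2 C f g" "\<gamma> \<in> hom2 C f g" "\<alpha> \<odot> \<beta> = \<alpha> \<odot> \<gamma>"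
  shows "\<beta> = \<gamma>"
proof -
  obtain \<alpha>' where a: "\<alpha> \<in> hom2 C g h" "\<alpha>' \<in> hom2 C h g" "\<alpha>' \<odot> \<alpha> = id2 C g"
    using assms(1) by (rule iso2E)
  have "(\<alpha>' \<odot> \<alpha>) \<odot> \<beta> = (\<alpha>' \<odot> \<alpha>) \<odot> \<gamma>"
    using assms(2,3,4) a(1,2) by (simp add: hom2_def)
  then show ?thesis using a(3) assms(2,3) by (simp add: hom2_def)
qed

text \<open>Both whiskerings agree because they become equal after composition with the invertible
  \<open>\<theta>\<close>, by interchange.\<close>
lemma whisker_iso_id1_commute:
  assumes "f \<in> hom1 C X X" "\<theta> \<in> iso2 C f (id1 C X)"
  shows "f \<rhd> \<theta> = \<theta> \<lhd> f"
proof (rule iso2_cancel_left[OF assms(2)])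
  have t: "\<theta> \<in> hom2 C f (id1 C X)" using assms(2) by (rule iso2_hom2)
  have X: "X \<in> Obj C" using hom1_Obj[OF assms(1)] by simp
  show "f \<rhd> \<theta> \<in> hom2 C (f \<cdot> f) f" "\<theta> \<lhd> f \<in> hom2 C (f \<cdot> f) f"
    using t X assms(1) by (auto simp: hom1_def hom2_def)
  show "\<theta> \<odot> (f \<rhd> \<theta>) = \<theta> \<odot> (\<theta> \<lhd> f)"
    using whisker_exchange[OF t t] t X assms(1) by (simp add: hom1_def hom2_def)
qed

subsection \<open>Zero objects of the Hom-categories\<close>

definition null1 :: "'a \<Rightarrow> bool"
  where "null1 f \<longleftrightarrow> f \<in> Mor1 C \<and> is_zero_object C (dom1 C f) (cod1 C f) f"

lemma null1_zero_object: "null1 f \<Longrightarrow> f \<in> hom1 C X Y \<Longrightarrow> is_zero_object C X Y f"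
  by (simp add: null1_def hom1_def)

lemma zero_object_null1: "is_zero_object C X Y f \<Longrightarrow> null1 f"
  by (auto simp: null1_def is_zero_object_def hom1_def)

lemma null1_from:
  assumes "null1 z" "z \<in> hom1 C X Y" "f \<in> hom1 C X Y"
  obtains \<alpha> where "\<alpha> \<in> hom2 C z f"
  using null1_zero_object[OF assms(1,2)] assms(3) by (auto simp: is_zero_object_def)

lemma null1_to:
  assumes "null1 z" "z \<in> hom1 C X Y" "f \<in> hom1 C X Y"
  obtains \<alpha> where "\<alpha> \<in> hom2 C f z"
  using null1_zero_object[OF assms(1,2)] assms(3) by (auto simp: is_zero_object_def)

lemma null1_from_unique:
  assumes "null1 z" "\<alpha> \<in> hom2 C z f" "\<beta> \<in> hom2 C z f"
  shows "\<alpha> = \<beta>"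
proof -
  have z: "z \<in> hom1 C (dom1 C z) (cod1 C z)" using assms(1) by (simp add: null1_def hom1_def)
  show ?thesis using hom2_parallel[OF assms(2) z] null1_zero_object[OF assms(1) z] assms(2,3)
    by (auto simp: is_zero_object_def)
qed

lemma null1_to_unique:
  assumes "null1 z" "\<alpha> \<in> hom2 C f z" "\<beta> \<in> hom2 C f z"
  shows "\<alpha> = \<beta>"
proof -
  have z: "z \<in> hom1 C (dom1 C z) (cod1 C z)" using assms(1) by (simp add: null1_def hom1_def)
  show ?thesis using hom2_parallel'[OF assms(2) z] null1_zero_object[OF assms(1) z] assms(2,3)
    by (auto simp: is_zero_object_def)
qed

text \<open>2-morphisms from and to \<open>f\<close> exist by composing through \<open>z\<close>.
  Two of them agree after composition with \<open>\<gamma>\<close> or \<open>\<beta>\<close>, and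
  the splitting \<open>\<gamma> \<odot> \<beta> = id2 C f\<close> cancels that factor. The vanishing
  results below all rest on this.\<close>

lemma null1_retract:
  assumes z: "null1 z" and b: "\<beta> \<in> hom2 C f z" and c: "\<gamma> \<in> hom2 C z f"
    and cb: "\<gamma> \<odot> \<beta> = id2 C f"
  shows "null1 f"
proof -
  let ?X = "dom1 C z" and ?Y = "cod1 C z"
  have zh: "z \<in> hom1 C ?X ?Y" using z by (simp add: null1_def hom1_def)
  have fh: "f \<in> hom1 C ?X ?Y" using b zh by (rule hom2_parallel')
  have "(\<exists>!\<alpha>. \<alpha> \<in> hom2 C f h) \<and> (\<exists>!\<alpha>. \<alpha> \<in> hom2 C h f)" if h: "h \<in> hom1 C ?X ?Y" for h
  proof (intro conjI ex_ex1I)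
    obtain \<delta> where d: "\<delta> \<in> hom2 C z h" using null1_from[OF z zh h] .
    show "\<exists>\<alpha>. \<alpha> \<in> hom2 C f h" using vcomp_hom2[OF b d] by blast
    obtain \<delta> where d: "\<delta> \<in> hom2 C h z" using null1_to[OF z zh h] .
    show "\<exists>\<alpha>. \<alpha> \<in> hom2 C h f" using vcomp_hom2[OF d c] by blast
  next
    fix \<alpha> \<alpha>' assume a: "\<alpha> \<in> hom2 C f h" "\<alpha>' \<in> hom2 C f h"
    have "\<alpha> \<odot> \<gamma> = \<alpha>' \<odot> \<gamma>"
      using null1_from_unique[OF z] vcomp_hom2[OF c a(1)] vcomp_hom2[OF c a(2)] by blast
    then have "\<alpha> \<odot> (\<gamma> \<odot> \<beta>) = \<alpha>' \<odot> (\<gamma> \<odot> \<beta>)"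
      using vcomp_assoc[OF b c a(1)] vcomp_assoc[OF b c a(2)] by simp
    then show "\<alpha> = \<alpha>'" using cb a by (simp add: hom2_def)
  next
    fix \<alpha> \<alpha>' assume a: "\<alpha> \<in> hom2 C h f" "\<alpha>' \<in> hom2 C h f"
    have "\<beta> \<odot> \<alpha> = \<beta> \<odot> \<alpha>'"
      using null1_to_unique[OF z] vcomp_hom2[OF a(1) b] vcomp_hom2[OF a(2) b] by blast
    then have "(\<gamma> \<odot> \<beta>) \<odot> \<alpha> = (\<gamma> \<odot> \<beta>) \<odot> \<alpha>'"
      using vcomp_assoc[OF a(1) b c] vcomp_assoc[OF a(2) b c] by simp
    then show "\<alpha> = \<alpha>'" using cb a by (simp add: hom2_def)
  qed
  then show ?thesis using fh by (auto simp: null1_def is_zero_object_def hom1_def)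
qed

lemma null1_iso:
  assumes "null1 z" "\<alpha> \<in> iso2 C f z"
  shows "null1 f"
proof -
  obtain \<beta> where "\<alpha> \<in> hom2 C f z" "\<beta> \<in> hom2 C z f" "\<beta> \<odot> \<alpha> = id2 C f"
    using assms(2) by (rule iso2E)
  then show ?thesis using null1_retract[OF assms(1)] by blast
qed

lemma null1_iso2:
  assumes "null1 z" "null1 w" "z \<in> hom1 C X Y" "w \<in> hom1 C X Y"
  obtains \<alpha> where "\<alpha> \<in> iso2 C z w"
proof -
  obtain \<alpha> where a: "\<alpha> \<in> hom2 C z w" using null1_from[OF assms(1,3,4)] .
  obtain \<beta> where b: "\<beta> \<in> hom2 C w z" using null1_from[OF assms(2,4,3)] .
  have "z \<in> Mor1 C" "w \<in> Mor1 C" using assms(3,4) by (auto simp: hom1_def)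
  then have "\<alpha> \<in> iso2 C z w"
    using null1_from_unique[OF assms(1) vcomp_hom2[OF a b] id2_hom2]
      null1_from_unique[OF assms(2) vcomp_hom2[OF b a] id2_hom2]
    by (intro iso2I[OF a b])
  then show ?thesis by (rule that)
qed

lemma zero_morphism2I:
  assumes "null1 z" "\<beta> \<in> hom2 C f z" "\<gamma> \<in> hom2 C z g"
  shows "is_zero_morphism2 C f g (\<gamma> \<odot> \<beta>)"
proof -
  have z: "z \<in> hom1 C (dom1 C z) (cod1 C z)" using assms(1) by (simp add: null1_def hom1_def)
  have "f \<in> hom1 C (dom1 C z) (cod1 C z)" using assms(2) z by (rule hom2_parallel')
  then show ?thesis
    using assms null1_zero_object[OF assms(1) z] by (auto simp: is_zero_morphism2_def hom1_def)
qed

lemma zero_morphism2E: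
  assumes "is_zero_morphism2 C f g \<alpha>" "f \<in> hom1 C X Y"
  obtains z \<beta> \<gamma> where "null1 z" "z \<in> hom1 C X Y" "\<beta> \<in> hom2 C f z" "\<gamma> \<in> hom2 C z g" "\<alpha> = \<gamma> \<odot> \<beta>"
proof -
  have f: "dom1 C f = X" "cod1 C f = Y" using assms(2) by (auto simp: hom1_def)
  obtain z \<beta> \<gamma> where z: "is_zero_object C X Y z" "\<beta> \<in> hom2 C f z" "\<gamma> \<in> hom2 C z g" "\<alpha> = \<gamma> \<odot> \<beta>"
    using assms(1) f by (auto simp: is_zero_morphism2_def)
  show ?thesis
    using z that[of z \<beta> \<gamma>] zero_object_null1[OF z(1)] by (simp add: is_zero_object_def)
qed

lemma zero_morphism2_hom2:
  assumes "is_zero_morphism2 C f g \<alpha>" "f \<in> hom1 C X Y"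
  shows "\<alpha> \<in> hom2 C f g"
  using zero_morphism2E[OF assms] vcomp_hom2 by metis

lemma zero_morphism2_vcomp_right:
  assumes "is_zero_morphism2 C f g \<alpha>" "f \<in> hom1 C X Y" "\<delta> \<in> hom2 C e f"
  shows "is_zero_morphism2 C e g (\<alpha> \<odot> \<delta>)"
proof -
  obtain z \<beta> \<gamma> where z: "null1 z" "\<beta> \<in> hom2 C f z" "\<gamma> \<in> hom2 C z g" "\<alpha> = \<gamma> \<odot> \<beta>"
    using assms(1,2) by (rule zero_morphism2E)
  then have "\<alpha> \<odot> \<delta> = \<gamma> \<odot> (\<beta> \<odot> \<delta>)" using vcomp_assoc[OF assms(3) z(2,3)] by simp
  then show ?thesis using zero_morphism2I[OF z(1) vcomp_hom2[OF assms(3) z(2)] z(3)] by simp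
qed

text \<open>The two factorizations may use different zero objects \<open>z\<close> and
  \<open>w\<close>; the 2-morphism \<open>u\<close> from \<open>z\<close> to \<open>w\<close> is
  compatible with both and identifies them.\<close>

lemma zero_morphism2_unique:
  assumes "is_zero_morphism2 C f g \<alpha>" "is_zero_morphism2 C f g \<beta>" "f \<in> hom1 C X Y"
  shows "\<alpha> = \<beta>"
proof -
  obtain z a b where z: "null1 z" "z \<in> hom1 C X Y" "a \<in> hom2 C f z" "b \<in> hom2 C z g" "\<alpha> = b \<odot> a"
    using assms(1,3) by (rule zero_morphism2E)
  obtain w c d where w: "null1 w" "w \<in> hom1 C X Y" "c \<in> hom2 C f w" "d \<in> hom2 C w g" "\<beta> = d \<odot> c"
    using assms(2,3) by (rule zero_morphism2E)
  obtain u where u: "u \<in> hom2 C z w" using null1_from[OF z(1,2) w(2)] .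
  have "b = d \<odot> u" using null1_from_unique[OF z(1,4) vcomp_hom2[OF u w(4)]] .
  moreover have "c = u \<odot> a" using null1_to_unique[OF w(1,3) vcomp_hom2[OF z(3) u]] .
  ultimately show ?thesis using z(5) w(5) vcomp_assoc[OF z(3) u w(4)] by simp
qed

text \<open>A zero \<open>w\<close> is a retract of every parallel \<open>k\<close>, because its
  only 2-endomorphism is the identity, and whiskering with \<open>z\<close> preserves retracts. So a
  single \<open>k\<close> with \<open>z \<cdot> k\<close> zero is enough.\<close>

lemma null1_comp_null1:
  assumes w: "null1 w" "w \<in> hom1 C X Y" and k: "k \<in> hom1 C X Y"
    and z: "z \<in> hom1 C Y Z" and zk: "null1 (z \<cdot> k)"
  shows "null1 (z \<cdot> w)"
proof -
  obtain \<alpha> where a: "\<alpha> \<in> hom2 C w k" using null1_from[OF w k] .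
  obtain \<beta> where b: "\<beta> \<in> hom2 C k w" using null1_to[OF w k] .
  have wM: "w \<in> Mor1 C" using w(2) by (simp add: hom1_def)
  have "\<beta> \<odot> \<alpha> = id2 C w" using null1_from_unique[OF w(1) vcomp_hom2[OF a b] id2_hom2[OF wM]] .
  moreover have "(z \<rhd> \<beta>) \<odot> (z \<rhd> \<alpha>) = z \<rhd> (\<beta> \<odot> \<alpha>)"
    using a b z w(2) k by (intro whisker_left_vcomp[symmetric]) (auto simp: hom1_def hom2_def)
  moreover have "z \<rhd> id2 C w = id2 C (z \<cdot> w)" using z w(2) by (simp add: hom1_def)
  ultimately show ?thesis
    using null1_retract[OF zk whisker_left_hom2[OF z w(2) a] whisker_left_hom2[OF z k b]]
    by simp
qed

text \<open>The 2-endomorphism \<open>\<zeta>\<close> of \<open>s\<close> with components \<open>0\<close> and \<open>1\<close> whiskers with \<open>w\<close> to the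
  identity, since \<open>w\<close> is a retract of \<open>iB \<cdot> 0\<close>; but \<open>w\<close> is also a retract of \<open>iA \<cdot> 0\<close>, so
  that the same whiskering factors through a zero object.\<close>
lemma coproduct_comp_null1:
  assumes iA: "iA \<in> hom1 C A U" and iB: "iB \<in> hom1 C B U"
    and full: "\<And>\<sigma> \<tau>. \<sigma> \<in> hom2 C (s \<cdot> iA) (s \<cdot> iA) \<Longrightarrow> \<tau> \<in> hom2 C (s \<cdot> iB) (s \<cdot> iB) \<Longrightarrow>
      \<exists>\<zeta>. \<zeta> \<in> hom2 C s s \<and> \<zeta> \<lhd> iA = \<sigma> \<and> \<zeta> \<lhd> iB = \<tau>"
    and s: "s \<in> hom1 C U Z" and w: "null1 w" "w \<in> hom1 C A U"
    and z: "null1 z" "z \<in> hom1 C A Z" and a: "null1 a" "a \<in> hom1 C A A" and b: "b \<in> hom1 C A B"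
  shows "null1 (s \<cdot> w)"
proof -
  have A: "A \<in> Obj C" using iA hom1_Obj by blast
  have ia: "iA \<cdot> a \<in> hom1 C A U" and ib: "iB \<cdot> b \<in> hom1 C A U"
    using comp1_hom1 a(2) b iA iB by blast+
  have siA: "s \<cdot> iA \<in> hom1 C A Z" and siB: "s \<cdot> iB \<in> hom1 C B Z"
    using comp1_hom1 s iA iB by blast+
  obtain \<beta> where \<beta>: "\<beta> \<in> hom2 C (s \<cdot> iA) z" using null1_to[OF z siA] .
  obtain \<gamma> where \<gamma>: "\<gamma> \<in> hom2 C z (s \<cdot> iA)" using null1_from[OF z siA] .
  obtain \<zeta> where \<zeta>: "\<zeta> \<in> hom2 C s s" "\<zeta> \<lhd> iA = \<gamma> \<odot> \<beta>" "\<zeta> \<lhd> iB = id2 C (s \<cdot> iB)"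
    using full[OF vcomp_hom2[OF \<beta> \<gamma>] id2_hom2] siB by (auto simp: hom1_def)
  obtain \<sigma> where \<sigma>: "\<sigma> \<in> hom2 C w (iA \<cdot> a)" using null1_from[OF w ia] .
  obtain \<sigma>' where \<sigma>': "\<sigma>' \<in> hom2 C (iA \<cdot> a) w" using null1_to[OF w ia] .
  obtain \<tau> where \<tau>: "\<tau> \<in> hom2 C w (iB \<cdot> b)" using null1_from[OF w ib] .
  obtain \<tau>' where \<tau>': "\<tau>' \<in> hom2 C (iB \<cdot> b) w" using null1_to[OF w ib] .
  have wM: "w \<in> Mor1 C" using w(2) by (simp add: hom1_def)
  have ss: "\<sigma>' \<odot> \<sigma> = id2 C w" using null1_from_unique[OF w(1) vcomp_hom2[OF \<sigma> \<sigma>'] id2_hom2[OF wM]] .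
  have tt: "\<tau>' \<odot> \<tau> = id2 C w" using null1_from_unique[OF w(1) vcomp_hom2[OF \<tau> \<tau>'] id2_hom2[OF wM]] .
  have ds: "dom1 C s = cod1 C w" using s w(2) by (simp add: hom1_def)
  note arrows = iA iB s w(2) z(2) a(2) b \<beta> \<gamma> \<zeta>(1) \<sigma> \<sigma>' \<tau> \<tau>'
  have "(\<zeta> \<lhd> (iB \<cdot> b)) = (\<zeta> \<lhd> iB) \<lhd> b" using arrows by (simp add: hom1_def hom2_def)
  then have "\<zeta> \<lhd> (iB \<cdot> b) = id2 C (s \<cdot> iB \<cdot> b)" using \<zeta>(3) arrows by (simp add: hom1_def)
  \<comment> \<open>Exchange of \<open>\<tau>\<close> and \<open>\<zeta>\<close>: on the
    \<open>iB\<close> side \<open>\<zeta>\<close> is the identity, so \<open>s \<rhd> \<tau>\<close>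
    absorbs \<open>\<zeta> \<lhd> w\<close>. Splitting off \<open>\<tau>'\<close> then shows that
    \<open>\<zeta> \<lhd> w\<close> is the identity.\<close>
  then have t: "s \<rhd> \<tau> = (s \<rhd> \<tau>) \<odot> (\<zeta> \<lhd> w)"
    using whisker_exchange[OF \<tau> \<zeta>(1) ds] arrows by (simp add: hom1_def hom2_def)
  have "\<zeta> \<lhd> w = (s \<rhd> (\<tau>' \<odot> \<tau>)) \<odot> (\<zeta> \<lhd> w)" using tt arrows by (simp add: hom1_def hom2_def)
  also have "\<dots> = (s \<rhd> \<tau>') \<odot> ((s \<rhd> \<tau>) \<odot> (\<zeta> \<lhd> w))"
    using arrows by (simp add: hom1_def hom2_def whisker_left_vcomp)
  also have "\<dots> = s \<rhd> (\<tau>' \<odot> \<tau>)"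
    unfolding t[symmetric] using arrows by (simp add: hom1_def hom2_def whisker_left_vcomp)
  finally have \<zeta>w: "\<zeta> \<lhd> w = id2 C (s \<cdot> w)" using tt arrows by (simp add: hom1_def)
  have "\<zeta> \<lhd> (iA \<cdot> a) = (\<zeta> \<lhd> iA) \<lhd> a" using arrows by (simp add: hom1_def hom2_def)
  also have "\<dots> = (\<gamma> \<lhd> a) \<odot> (\<beta> \<lhd> a)"
    unfolding \<zeta>(2) using arrows by (simp add: hom1_def hom2_def whisker_right_vcomp)
  finally have \<zeta>a: "\<zeta> \<lhd> (iA \<cdot> a) = (\<gamma> \<lhd> a) \<odot> (\<beta> \<lhd> a)" .
  \<comment> \<open>Now the same whiskering is moved past \<open>\<sigma>\<close> to the
    \<open>iA\<close> side, where \<open>\<zeta>\<close> is \<open>\<gamma> \<odot> \<beta>\<close>.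
    This exhibits \<open>s \<cdot> w\<close> as a retract of \<open>z \<cdot> a\<close>.\<close>
  have "id2 C (s \<cdot> w) = (s \<rhd> (\<sigma>' \<odot> \<sigma>)) \<odot> (\<zeta> \<lhd> w)"
    using ss \<zeta>w arrows by (simp add: hom1_def hom2_def)
  also have "\<dots> = (s \<rhd> \<sigma>') \<odot> ((s \<rhd> \<sigma>) \<odot> (\<zeta> \<lhd> w))"
    using arrows by (simp add: hom1_def hom2_def whisker_left_vcomp)
  also have "\<dots> = (s \<rhd> \<sigma>') \<odot> (((\<gamma> \<lhd> a) \<odot> (\<beta> \<lhd> a)) \<odot> (s \<rhd> \<sigma>))"
    using whisker_exchange[OF \<sigma> \<zeta>(1) ds] \<zeta>a by simp
  also have "\<dots> = ((s \<rhd> \<sigma>') \<odot> (\<gamma> \<lhd> a)) \<odot> ((\<beta> \<lhd> a) \<odot> (s \<rhd> \<sigma>))"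
    using arrows by (simp add: hom1_def hom2_def)
  finally have id: "((s \<rhd> \<sigma>') \<odot> (\<gamma> \<lhd> a)) \<odot> ((\<beta> \<lhd> a) \<odot> (s \<rhd> \<sigma>)) = id2 C (s \<cdot> w)" ..
  \<comment> \<open>The identity of \<open>A\<close> is parallel to \<open>a\<close>, and its
    composite with \<open>z\<close> is \<open>z\<close> itself, which is zero.\<close>
  have "null1 (z \<cdot> a)"
    by (rule null1_comp_null1[OF a id1_hom1[OF A] z(2)]) (use z A in \<open>simp add: hom1_def\<close>)
  moreover have "(\<beta> \<lhd> a) \<odot> (s \<rhd> \<sigma>) \<in> hom2 C (s \<cdot> w) (z \<cdot> a)"
    "(s \<rhd> \<sigma>') \<odot> (\<gamma> \<lhd> a) \<in> hom2 C (z \<cdot> a) (s \<cdot> w)"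
    using arrows by (simp_all add: hom1_def hom2_def)
  ultimately show ?thesis using id null1_retract by blast
qed

subsection \<open>Weak 2-products\<close>

text \<open>The cones are taken to be \<open>pA \<cdot> b\<close>, \<open>pB \<cdot> b\<close>
  themselves, with identities as the 2-isomorphisms. The second clause of the universal property
  then says that composing with the projections is fully faithful.\<close>

lemma weak_2_product_ex1:
  assumes "weak_2_product C A B P pA pB" "b \<in> hom1 C X P" "b' \<in> hom1 C X P"
    "\<sigma> \<in> hom2 C (pA \<cdot> b) (pA \<cdot> b')" "\<tau> \<in> hom2 C (pB \<cdot> b) (pB \<cdot> b')"
  shows "\<exists>!\<gamma>. \<gamma> \<in> hom2 C b b' \<and> pA \<rhd> \<gamma> = \<sigma> \<and> pB \<rhd> \<gamma> = \<tau>"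
proof -
  have p: "pA \<in> hom1 C P A" "pB \<in> hom1 C P B" using assms(1) by (auto simp: weak_2_product_def)
  have X: "X \<in> Obj C" using hom1_Obj[OF assms(2)] by simp
  have pb: "pA \<cdot> b \<in> hom1 C X A" "pB \<cdot> b \<in> hom1 C X B" "pA \<cdot> b' \<in> hom1 C X A" "pB \<cdot> b' \<in> hom1 C X B"
    using comp1_hom1 p assms(2,3) by blast+
  have M: "pA \<cdot> b \<in> Mor1 C" "pB \<cdot> b \<in> Mor1 C" "pA \<cdot> b' \<in> Mor1 C" "pB \<cdot> b' \<in> Mor1 C"
    using pb by (auto simp: hom1_def)
  have "\<exists>!\<gamma>. \<gamma> \<in> hom2 C b b' \<and>
      pA \<rhd> \<gamma> = inv2 C (id2 C (pA \<cdot> b')) \<odot> \<sigma> \<odot> id2 C (pA \<cdot> b) \<and>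
      pB \<rhd> \<gamma> = inv2 C (id2 C (pB \<cdot> b')) \<odot> \<tau> \<odot> id2 C (pB \<cdot> b)"
    using assms(1)[unfolded weak_2_product_def, THEN conjunct2, THEN conjunct2, THEN conjunct2,
      THEN conjunct2, THEN bspec, OF X, THEN bspec, OF pb(1), THEN bspec, OF pb(2),
      THEN bspec, OF assms(2), THEN bspec, OF id2_iso2[OF M(1)], THEN bspec, OF id2_iso2[OF M(2)],
      THEN bspec, OF pb(3), THEN bspec, OF pb(4),
      THEN bspec, OF assms(3), THEN bspec, OF id2_iso2[OF M(3)], THEN bspec, OF id2_iso2[OF M(4)],
      THEN bspec, OF assms(4), THEN bspec, OF assms(5)] .
  moreover have "\<sigma> \<in> Mor2 C" "dom2 C \<sigma> = pA \<cdot> b" "cod2 C \<sigma> = pA \<cdot> b'"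
    "\<tau> \<in> Mor2 C" "dom2 C \<tau> = pB \<cdot> b" "cod2 C \<tau> = pB \<cdot> b'" using assms(4,5) by (auto simp: hom2_def)
  ultimately show ?thesis using M by (simp add: inv2_id2)
qed

lemma weak_2_product_unique:
  assumes P: "weak_2_product C A B P pA pB" and b: "b \<in> hom1 C X P"
    and \<gamma>: "\<gamma> \<in> hom2 C b b" "pA \<rhd> \<gamma> = id2 C (pA \<cdot> b)" "pB \<rhd> \<gamma> = id2 C (pB \<cdot> b)"
  shows "\<gamma> = id2 C b"
proof -
  have p: "pA \<in> hom1 C P A" "pB \<in> hom1 C P B" using P by (auto simp: weak_2_product_def)
  have M: "pA \<cdot> b \<in> Mor1 C" "pB \<cdot> b \<in> Mor1 C" "b \<in> Mor1 C" using p b by (auto simp: hom1_def)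
  have "id2 C b \<in> hom2 C b b" "pA \<rhd> id2 C b = id2 C (pA \<cdot> b)" "pB \<rhd> id2 C b = id2 C (pB \<cdot> b)"
    using p b by (auto simp: hom1_def hom2_def)
  then show ?thesis
    using weak_2_product_ex1[OF P b b id2_hom2[OF M(1)] id2_hom2[OF M(2)]] \<gamma> by blast
qed

text \<open>A fully faithful functor reflects isomorphisms: the inverses of the components lift as
  well, and by uniqueness both composites of the lifts are identities.\<close>

lemma weak_2_product_iso2:
  assumes P: "weak_2_product C A B P pA pB" and b: "b \<in> hom1 C X P" "b' \<in> hom1 C X P"
    and \<sigma>: "\<sigma> \<in> iso2 C (pA \<cdot> b) (pA \<cdot> b')" and \<tau>: "\<tau> \<in> iso2 C (pB \<cdot> b) (pB \<cdot> b')"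
  obtains \<gamma> where "\<gamma> \<in> iso2 C b b'" "pA \<rhd> \<gamma> = \<sigma>" "pB \<rhd> \<gamma> = \<tau>"
proof -
  have p: "pA \<in> hom1 C P A" "pB \<in> hom1 C P B" using P by (auto simp: weak_2_product_def)
  obtain \<sigma>' where s: "\<sigma> \<in> hom2 C (pA \<cdot> b) (pA \<cdot> b')" "\<sigma>' \<in> hom2 C (pA \<cdot> b') (pA \<cdot> b)"
      "\<sigma>' \<odot> \<sigma> = id2 C (pA \<cdot> b)" "\<sigma> \<odot> \<sigma>' = id2 C (pA \<cdot> b')"
    using \<sigma> by (rule iso2E)
  obtain \<tau>' where t: "\<tau> \<in> hom2 C (pB \<cdot> b) (pB \<cdot> b')" "\<tau>' \<in> hom2 C (pB \<cdot> b') (pB \<cdot> b)"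
      "\<tau>' \<odot> \<tau> = id2 C (pB \<cdot> b)" "\<tau> \<odot> \<tau>' = id2 C (pB \<cdot> b')"
    using \<tau> by (rule iso2E)
  obtain \<gamma> where c: "\<gamma> \<in> hom2 C b b'" "pA \<rhd> \<gamma> = \<sigma>" "pB \<rhd> \<gamma> = \<tau>"
    using weak_2_product_ex1[OF P b s(1) t(1)] by blast
  obtain \<gamma>' where c': "\<gamma>' \<in> hom2 C b' b" "pA \<rhd> \<gamma>' = \<sigma>'" "pB \<rhd> \<gamma>' = \<tau>'"
    using weak_2_product_ex1[OF P b(2,1) s(2) t(2)] by blast
  have "pA \<rhd> (\<gamma>' \<odot> \<gamma>) = \<sigma>' \<odot> \<sigma>" "pB \<rhd> (\<gamma>' \<odot> \<gamma>) = \<tau>' \<odot> \<tau>"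
    "pA \<rhd> (\<gamma> \<odot> \<gamma>') = \<sigma> \<odot> \<sigma>'" "pB \<rhd> (\<gamma> \<odot> \<gamma>') = \<tau> \<odot> \<tau>'"
    using p b c c' by (auto simp: hom1_def hom2_def whisker_left_vcomp)
  then have "\<gamma>' \<odot> \<gamma> = id2 C b" "\<gamma> \<odot> \<gamma>' = id2 C b'"
    using s(3,4) t(3,4) vcomp_hom2 c(1) c'(1)
      weak_2_product_unique[OF P b(1), of "\<gamma>' \<odot> \<gamma>"] weak_2_product_unique[OF P b(2), of "\<gamma> \<odot> \<gamma>'"]
    by metis+
  then show ?thesis using that c iso2I[OF c(1) c'(1)] by blast
qed

subsection \<open>Adjoint equivalences\<close>

text \<open>The usual improvement of an equivalence to an adjoint one: the counit is corrected so
  that one triangle identity holds, and the other follows because its composite is an idempotent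
  isomorphism.\<close>

lemma is_equivalenceI:
  assumes r: "r \<in> hom1 C U P" and r': "r' \<in> hom1 C P U"
    and \<alpha>: "\<alpha> \<in> iso2 C (r \<cdot> r') (id1 C P)" and \<beta>: "\<beta> \<in> iso2 C (id1 C U) (r' \<cdot> r)"
  shows "is_equivalence C U P r"
proof -
  have UP: "U \<in> Obj C" "P \<in> Obj C" using hom1_Obj[OF r] by auto
  have rr: "r \<in> Mor1 C" "dom1 C r = U" "cod1 C r = P" "r' \<in> Mor1 C" "dom1 C r' = P" "cod1 C r' = U"
    using r r' by (auto simp: hom1_def)
  have h: "\<alpha> \<in> Mor2 C" "dom2 C \<alpha> = r \<cdot> r'" "cod2 C \<alpha> = id1 C P"
    "\<beta> \<in> Mor2 C" "dom2 C \<beta> = id1 C U" "cod2 C \<beta> = r' \<cdot> r"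
    using iso2_hom2[OF \<alpha>] iso2_hom2[OF \<beta>] by (auto simp: hom2_def)
  note [simp] = UP rr h
  have ar: "\<alpha> \<lhd> r \<in> iso2 C (r \<cdot> r' \<cdot> r) r"
    using iso2_whisker_right[OF r comp1_hom1[OF r' r] \<alpha>] by simp
  have rb: "r \<rhd> \<beta> \<in> iso2 C r (r \<cdot> r' \<cdot> r)"
    using iso2_whisker_left[OF r id1_hom1 \<beta>] by simp
  obtain \<delta> where d: "\<delta> \<in> hom2 C r r" "\<delta> \<odot> ((\<alpha> \<lhd> r) \<odot> (r \<rhd> \<beta>)) = id2 C r"
      "((\<alpha> \<lhd> r) \<odot> (r \<rhd> \<beta>)) \<odot> \<delta> = id2 C r" "\<delta> \<in> iso2 C r r"
    using iso2_vcomp[OF rb ar] by (rule iso2E)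
  have [simp]: "\<delta> \<in> Mor2 C" "dom2 C \<delta> = r" "cod2 C \<delta> = r" using d(1) by (auto simp: hom2_def)
  \<comment> \<open>\<open>\<delta>\<close> inverts the triangle composite formed with
    \<open>\<alpha>\<close>, so inserting it into the counit turns that composite into the
    identity.\<close>
  define \<xi> where "\<xi> = \<alpha> \<odot> (\<delta> \<lhd> r')"
  have xi: "\<xi> \<in> iso2 C (r \<cdot> r') (id1 C P)"
    unfolding \<xi>_def by (rule iso2_vcomp[OF iso2_whisker_right[OF r' r d(4)] \<alpha>])
  have [simp]: "\<xi> \<in> Mor2 C" "dom2 C \<xi> = r \<cdot> r'" "cod2 C \<xi> = id1 C P"
    using iso2_hom2[OF xi] by (auto simp: hom2_def)
  have "(\<xi> \<lhd> r) \<odot> (r \<rhd> \<beta>) = (\<alpha> \<lhd> r) \<odot> ((\<delta> \<lhd> (r' \<cdot> r)) \<odot> (r \<rhd> \<beta>))"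
    by (simp add: \<xi>_def whisker_right_vcomp)
  also have "(\<delta> \<lhd> (r' \<cdot> r)) \<odot> (r \<rhd> \<beta>) = (r \<rhd> \<beta>) \<odot> \<delta>"
    using whisker_exchange[OF iso2_hom2[OF \<beta>] d(1)] by simp
  also have "(\<alpha> \<lhd> r) \<odot> ((r \<rhd> \<beta>) \<odot> \<delta>) = id2 C r" using d(3) by simp
  finally have triangle: "(\<xi> \<lhd> r) \<odot> (r \<rhd> \<beta>) = id2 C r" .
  let ?t = "(r' \<rhd> \<xi>) \<odot> (\<beta> \<lhd> r')"
  have t: "?t \<in> iso2 C r' r'"
    using iso2_vcomp[OF iso2_whisker_right[OF r' id1_hom1 \<beta>]]
      iso2_whisker_left[OF r' comp1_hom1[OF r' r] xi] by simp
  have [simp]: "?t \<in> Mor2 C" "dom2 C ?t = r'" "cod2 C ?t = r'"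
    using iso2_hom2[OF t] by (auto simp: hom2_def)
  have x: "(\<beta> \<lhd> r') \<odot> (r' \<rhd> \<xi>) = ((r' \<cdot> r \<cdot> r') \<rhd> \<xi>) \<odot> (\<beta> \<lhd> (r' \<cdot> r \<cdot> r'))"
    using whisker_exchange[of "r' \<rhd> \<xi>" "r' \<cdot> r \<cdot> r'" r' \<beta> "id1 C U" "r' \<cdot> r"]
    by (simp add: hom2_def)
  \<comment> \<open>Exchanging \<open>\<xi>\<close> with itself, and \<open>\<beta>\<close> with
    itself in \<open>yy\<close>, moves the inner counit and unit next to each other as a whiskered
    copy of the first triangle.\<close>
  have xx: "(r' \<rhd> \<xi>) \<odot> ((r' \<cdot> r \<cdot> r') \<rhd> \<xi>) = (r' \<rhd> \<xi>) \<odot> (r' \<rhd> (\<xi> \<lhd> (r \<cdot> r')))"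
  proof -
    have "\<xi> \<odot> ((r \<cdot> r') \<rhd> \<xi>) = \<xi> \<odot> (\<xi> \<lhd> (r \<cdot> r'))"
      using whisker_exchange[OF iso2_hom2[OF xi] iso2_hom2[OF xi]] by simp
    from arg_cong[OF this, of "\<lambda>\<alpha>. r' \<rhd> \<alpha>"] show ?thesis by (simp add: whisker_left_vcomp)
  qed
  have yy: "(\<beta> \<lhd> (r' \<cdot> r \<cdot> r')) \<odot> (\<beta> \<lhd> r') = ((r' \<cdot> r) \<rhd> (\<beta> \<lhd> r')) \<odot> (\<beta> \<lhd> r')"
  proof -
    have "(\<beta> \<lhd> (r' \<cdot> r)) \<odot> \<beta> = ((r' \<cdot> r) \<rhd> \<beta>) \<odot> \<beta>"
      using whisker_exchange[OF iso2_hom2[OF \<beta>] iso2_hom2[OF \<beta>]] by simp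
    from arg_cong[OF this, of "\<lambda>\<alpha>. \<alpha> \<lhd> r'"] show ?thesis by (simp add: whisker_right_vcomp)
  qed
  have mid: "(r' \<rhd> (\<xi> \<lhd> (r \<cdot> r'))) \<odot> ((r' \<cdot> r) \<rhd> (\<beta> \<lhd> r')) = id2 C (r' \<cdot> r \<cdot> r')"
  proof -
    have "r' \<rhd> (((\<xi> \<lhd> r) \<odot> (r \<rhd> \<beta>)) \<lhd> r') = id2 C (r' \<cdot> r \<cdot> r')"
      unfolding triangle by simp
    then show ?thesis by (simp add: whisker_left_vcomp whisker_right_vcomp)
  qed
  \<comment> \<open>The second triangle composite is shown to be idempotent; being invertible, it
    can be cancelled once and is the identity.\<close>
  have "?t \<odot> ?t = (r' \<rhd> \<xi>) \<odot> (((\<beta> \<lhd> r') \<odot> (r' \<rhd> \<xi>)) \<odot> (\<beta> \<lhd> r'))" by simp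
  also have "\<dots> = ((r' \<rhd> \<xi>) \<odot> ((r' \<cdot> r \<cdot> r') \<rhd> \<xi>)) \<odot> ((\<beta> \<lhd> (r' \<cdot> r \<cdot> r')) \<odot> (\<beta> \<lhd> r'))"
    unfolding x by simp
  also have "\<dots> = (r' \<rhd> \<xi>) \<odot> (((r' \<rhd> (\<xi> \<lhd> (r \<cdot> r'))) \<odot> ((r' \<cdot> r) \<rhd> (\<beta> \<lhd> r'))) \<odot> (\<beta> \<lhd> r'))"
    unfolding xx yy by simp
  also have "\<dots> = ?t \<odot> id2 C r'" unfolding mid by simp
  finally have "?t = id2 C r'"
    by (rule iso2_cancel_left[OF t _ _, rotated 2]) (simp_all add: hom2_def)
  then show ?thesis
    unfolding is_equivalence_def using r r' xi \<beta> triangle by blast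
qed

end

section \<open>Addition of 2-morphisms and biproducts under whiskering\<close>

locale semiadditive_two_category = two_category C
  for C :: "('o, 'a, 'c, 'z) semiadditive_two_cat_scheme" (structure) +
  assumes semiadditive: "locally_semiadditive C"
    and distributive: "compositionally_distributive C"
begin

lemma null1_zero1:
  assumes "X \<in> Obj C" "Y \<in> Obj C"
  shows "null1 (zero1 C Y X)" "zero1 C Y X \<in> hom1 C X Y"
proof -
  have "is_zero_object C X Y (zero1 C Y X)"
    using assms semiadditive by (simp add: locally_semiadditive_def)
  then show "null1 (zero1 C Y X)" "zero1 C Y X \<in> hom1 C X Y"
    by (auto simp: zero_object_null1 is_zero_object_def)
qed

lemma biproduct:
  assumes "f \<in> hom1 C X Y" "g \<in> hom1 C X Y"
  shows "is_biproduct C f g (f \<oplus> g) (proj1 C f g) (proj2 C f g) (inj1 C f g) (inj2 C f g)"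
  using assms semiadditive hom1_Obj[OF assms(1)] by (simp add: locally_semiadditive_def)

lemma biproduct_arr:
  assumes "f \<in> hom1 C X Y" "g \<in> hom1 C X Y"
  shows "f \<oplus> g \<in> hom1 C X Y"
    "proj1 C f g \<in> hom2 C (f \<oplus> g) f" "proj2 C f g \<in> hom2 C (f \<oplus> g) g"
    "inj1 C f g \<in> hom2 C f (f \<oplus> g)" "inj2 C f g \<in> hom2 C g (f \<oplus> g)"
    "proj1 C f g \<odot> inj1 C f g = id2 C f" "proj2 C f g \<odot> inj2 C f g = id2 C g"
    "is_zero_morphism2 C g f (proj1 C f g \<odot> inj2 C f g)"
    "is_zero_morphism2 C f g (proj2 C f g \<odot> inj1 C f g)"
  using biproduct[OF assms] assms by (auto simp: is_biproduct_def hom1_def)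

lemma biproduct_pair_ex1:
  assumes "f \<in> hom1 C X Y" "g \<in> hom1 C X Y" "\<alpha> \<in> hom2 C h f" "\<beta> \<in> hom2 C h g"
  shows "\<exists>!\<gamma>. \<gamma> \<in> hom2 C h (f \<oplus> g) \<and> proj1 C f g \<odot> \<gamma> = \<alpha> \<and> proj2 C f g \<odot> \<gamma> = \<beta>"
  using biproduct[OF assms(1,2)] hom2_parallel'[OF assms(3,1)] assms
  by (simp add: is_biproduct_def hom1_def)

lemma biproduct_copair_ex1:
  assumes "f \<in> hom1 C X Y" "g \<in> hom1 C X Y" "\<alpha> \<in> hom2 C f h" "\<beta> \<in> hom2 C g h"
  shows "\<exists>!\<gamma>. \<gamma> \<in> hom2 C (f \<oplus> g) h \<and> \<gamma> \<odot> inj1 C f g = \<alpha> \<and> \<gamma> \<odot> inj2 C f g = \<beta>"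
  using biproduct[OF assms(1,2)] hom2_parallel[OF assms(3,1)] assms
  by (simp add: is_biproduct_def hom1_def)

lemma pair2_eq:
  assumes "g \<in> hom1 C X Y" "\<gamma> \<in> hom2 C f (g \<oplus> g)"
    "proj1 C g g \<odot> \<gamma> = \<alpha>" "proj2 C g g \<odot> \<gamma> = \<beta>" "\<alpha> \<in> hom2 C f g" "\<beta> \<in> hom2 C f g"
  shows "pair2 C \<alpha> \<beta> = \<gamma>"
  unfolding pair2_def
  using biproduct_pair_ex1[OF assms(1,1,5,6)] assms(2-6)
  by (intro the1_equality) (simp_all add: hom2_def)

lemma codiag2:
  assumes "g \<in> hom1 C X Y"
  shows "codiag2 C g \<in> hom2 C (g \<oplus> g) g"
    "codiag2 C g \<odot> inj1 C g g = id2 C g" "codiag2 C g \<odot> inj2 C g g = id2 C g"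
proof -
  have "id2 C g \<in> hom2 C g g" using assms id2_hom2 by (simp add: hom1_def)
  from theI'[OF biproduct_copair_ex1[OF assms assms this this]]
  show "codiag2 C g \<in> hom2 C (g \<oplus> g) g"
    "codiag2 C g \<odot> inj1 C g g = id2 C g" "codiag2 C g \<odot> inj2 C g g = id2 C g"
    by (simp_all add: codiag2_def)
qed

text \<open>The pairing of \<open>\<alpha>\<close> with a zero 2-morphism is \<open>\<alpha>\<close>
  followed by an injection into \<open>g \<oplus> g\<close>, and the codiagonal restricts to the
  identity along that injection.\<close>

lemma add2_zero:
  assumes f: "f \<in> hom1 C X Y" and \<alpha>: "\<alpha> \<in> hom2 C f g" and \<zeta>: "is_zero_morphism2 C f g \<zeta>"
  shows "\<alpha> \<boxplus> \<zeta> = \<alpha>" "\<zeta> \<boxplus> \<alpha> = \<alpha>"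
proof -
  have g: "g \<in> hom1 C X Y" using \<alpha> f by (rule hom2_parallel)
  have z: "\<zeta> \<in> hom2 C f g" using \<zeta> f by (rule zero_morphism2_hom2)
  note b = biproduct_arr[OF g g] and c = codiag2[OF g]
  have p1: "proj2 C g g \<odot> (inj1 C g g \<odot> \<alpha>) = \<zeta>" and p2: "proj1 C g g \<odot> (inj2 C g g \<odot> \<alpha>) = \<zeta>"
    using zero_morphism2_unique[OF zero_morphism2_vcomp_right[OF b(9) g \<alpha>] \<zeta> f]
      zero_morphism2_unique[OF zero_morphism2_vcomp_right[OF b(8) g \<alpha>] \<zeta> f]
      vcomp_assoc[OF \<alpha> b(4,3)] vcomp_assoc[OF \<alpha> b(5,2)] by simp_all
  have q: "proj1 C g g \<odot> (inj1 C g g \<odot> \<alpha>) = \<alpha>" "proj2 C g g \<odot> (inj2 C g g \<odot> \<alpha>) = \<alpha>"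
    using vcomp_assoc[OF \<alpha> b(4,2)] vcomp_assoc[OF \<alpha> b(5,3)] b(6,7) vcomp_id2_left[OF \<alpha>] by simp_all
  have "pair2 C \<alpha> \<zeta> = inj1 C g g \<odot> \<alpha>"
    by (rule pair2_eq[OF g vcomp_hom2[OF \<alpha> b(4)] q(1) p1 \<alpha> z])
  moreover have "pair2 C \<zeta> \<alpha> = inj2 C g g \<odot> \<alpha>"
    by (rule pair2_eq[OF g vcomp_hom2[OF \<alpha> b(5)] p2 q(2) z \<alpha>])
  moreover have "cod2 C \<alpha> = g" "cod2 C \<zeta> = g" using \<alpha> z by (auto simp: hom2_def)
  ultimately show "\<alpha> \<boxplus> \<zeta> = \<alpha>" "\<zeta> \<boxplus> \<alpha> = \<alpha>"
    using vcomp_assoc[OF \<alpha> b(4) c(1)] vcomp_assoc[OF \<alpha> b(5) c(1)] c(2,3) vcomp_id2_left[OF \<alpha>]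
    by (simp_all add: add2_def)
qed

lemma add2_hom2:
  assumes "f \<in> hom1 C X Y" "\<alpha> \<in> hom2 C f g" "\<beta> \<in> hom2 C f g"
  shows "\<alpha> \<boxplus> \<beta> \<in> hom2 C f g"
proof -
  have g: "g \<in> hom1 C X Y" using assms(2,1) by (rule hom2_parallel)
  have c: "cod2 C \<alpha> = g" using assms(2) by (simp add: hom2_def)
  obtain \<gamma> where \<gamma>: "\<gamma> \<in> hom2 C f (g \<oplus> g)" "proj1 C g g \<odot> \<gamma> = \<alpha>" "proj2 C g g \<odot> \<gamma> = \<beta>"
    using biproduct_pair_ex1[OF g g assms(2,3)] by blast
  show ?thesis
    using vcomp_hom2[OF \<gamma>(1) codiag2(1)[OF g]] pair2_eq[OF g \<gamma> assms(2,3)] c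
    by (simp add: add2_def)
qed

lemma vcomp_add2:
  assumes "f \<in> hom1 C X Y" "\<beta> \<in> hom2 C f g" "\<gamma> \<in> hom2 C f g" "\<alpha> \<in> hom2 C g h"
  shows "\<alpha> \<odot> (\<beta> \<boxplus> \<gamma>) = (\<alpha> \<odot> \<beta>) \<boxplus> (\<alpha> \<odot> \<gamma>)"
  using distributive assms hom1_Obj[OF assms(1)] hom2_parallel[OF assms(2,1)]
    hom2_parallel[OF assms(4) hom2_parallel[OF assms(2,1)]]
  unfolding compositionally_distributive_def by blast

lemma hcomp_add2_right:
  assumes "f \<in> hom1 C X Y" "g \<in> hom1 C Y Z"
    "\<alpha> \<in> hom2 C f f'" "\<beta> \<in> hom2 C f f'" "\<gamma> \<in> hom2 C g g'"
  shows "\<gamma> \<star> (\<alpha> \<boxplus> \<beta>) = (\<gamma> \<star> \<alpha>) \<boxplus> (\<gamma> \<star> \<beta>)"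
  using distributive[unfolded compositionally_distributive_def, THEN conjunct1,
    THEN bspec, OF hom1_Obj(1)[OF assms(1)], THEN bspec, OF hom1_Obj(2)[OF assms(1)],
    THEN bspec, OF hom1_Obj(2)[OF assms(2)], THEN bspec, OF assms(1),
    THEN bspec, OF hom2_parallel[OF assms(3,1)], THEN bspec, OF assms(2),
    THEN bspec, OF hom2_parallel[OF assms(5,2)],
    THEN bspec, OF assms(3), THEN bspec, OF assms(4), THEN bspec, OF assms(5)] .

lemma hcomp_add2_left:
  assumes "f \<in> hom1 C X Y" "g \<in> hom1 C Y Z"
    "\<alpha> \<in> hom2 C g g'" "\<beta> \<in> hom2 C g g'" "\<gamma> \<in> hom2 C f f'"
  shows "(\<alpha> \<boxplus> \<beta>) \<star> \<gamma> = (\<alpha> \<star> \<gamma>) \<boxplus> (\<beta> \<star> \<gamma>)"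
  using distributive[unfolded compositionally_distributive_def, THEN conjunct2, THEN conjunct1,
    THEN bspec, OF hom1_Obj(1)[OF assms(1)], THEN bspec, OF hom1_Obj(2)[OF assms(1)],
    THEN bspec, OF hom1_Obj(2)[OF assms(2)], THEN bspec, OF assms(1),
    THEN bspec, OF hom2_parallel[OF assms(5,1)], THEN bspec, OF assms(2),
    THEN bspec, OF hom2_parallel[OF assms(3,2)],
    THEN bspec, OF assms(3), THEN bspec, OF assms(4), THEN bspec, OF assms(5)] .

lemma whisker_left_add2:
  assumes "h \<in> hom1 C Y Z" "f \<in> hom1 C X Y" "\<alpha> \<in> hom2 C f g" "\<beta> \<in> hom2 C f g"
  shows "h \<rhd> (\<alpha> \<boxplus> \<beta>) = (h \<rhd> \<alpha>) \<boxplus> (h \<rhd> \<beta>)"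
proof -
  have "id2 C h \<in> hom2 C h h" using assms(1) id2_hom2 by (simp add: hom1_def)
  then show ?thesis
    unfolding whisker_left_def using hcomp_add2_right assms by blast
qed

text \<open>Both sides have the same composites with the two projections: composition distributes
  over the sum, and the mixed terms are zero 2-morphisms. This equation is the form in which a
  biproduct can be whiskered.\<close>

lemma biproduct_id2:
  assumes f: "f \<in> hom1 C X Y" and g: "g \<in> hom1 C X Y"
  shows "(inj1 C f g \<odot> proj1 C f g) \<boxplus> (inj2 C f g \<odot> proj2 C f g) = id2 C (f \<oplus> g)"
proof -
  note b = biproduct_arr[OF f g]
  let ?e1 = "inj1 C f g \<odot> proj1 C f g" and ?e2 = "inj2 C f g \<odot> proj2 C f g"
  have e: "?e1 \<in> hom2 C (f \<oplus> g) (f \<oplus> g)" "?e2 \<in> hom2 C (f \<oplus> g) (f \<oplus> g)"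
    using vcomp_hom2 b by blast+
  have s: "f \<oplus> g \<in> Mor1 C" using b(1) by (simp add: hom1_def)
  have "proj1 C f g \<odot> ?e1 = proj1 C f g" "proj2 C f g \<odot> ?e2 = proj2 C f g"
    using vcomp_assoc[OF b(2,4,2)] vcomp_assoc[OF b(3,5,3)] b(6,7)
      vcomp_id2_left[OF b(2)] vcomp_id2_left[OF b(3)] by simp_all
  moreover have "is_zero_morphism2 C (f \<oplus> g) f (proj1 C f g \<odot> ?e2)"
    "is_zero_morphism2 C (f \<oplus> g) g (proj2 C f g \<odot> ?e1)"
    using zero_morphism2_vcomp_right[OF b(8) g b(3)] zero_morphism2_vcomp_right[OF b(9) f b(2)]
      vcomp_assoc[OF b(3,5,2)] vcomp_assoc[OF b(2,4,3)] by simp_all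
  ultimately have "proj1 C f g \<odot> (?e1 \<boxplus> ?e2) = proj1 C f g" "proj2 C f g \<odot> (?e1 \<boxplus> ?e2) = proj2 C f g"
    using vcomp_add2[OF b(1) e b(2)] vcomp_add2[OF b(1) e b(3)] add2_zero[OF b(1)] b(2,3) by simp_all
  moreover have "proj1 C f g \<odot> id2 C (f \<oplus> g) = proj1 C f g" "proj2 C f g \<odot> id2 C (f \<oplus> g) = proj2 C f g"
    using vcomp_id2_right[OF b(2)] vcomp_id2_right[OF b(3)] by auto
  ultimately show ?thesis
    using biproduct_pair_ex1[OF f g b(2,3)] add2_hom2[OF b(1) e] id2_hom2[OF s] by blast
qed

text \<open>Whiskering need not preserve biproducts, since distributivity says nothing about zero
  objects.  It does so as soon as it annihilates one of the summands.\<close>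
lemma whisker_proj_iso2:
  assumes h: "h \<in> hom1 C Y Z" and f: "f \<in> hom1 C X Y" and g: "g \<in> hom1 C X Y"
  shows "null1 (h \<cdot> g) \<Longrightarrow> h \<rhd> proj1 C f g \<in> iso2 C (h \<cdot> (f \<oplus> g)) (h \<cdot> f)" (is "_ \<Longrightarrow> ?G1")
    and "null1 (h \<cdot> f) \<Longrightarrow> h \<rhd> proj2 C f g \<in> iso2 C (h \<cdot> (f \<oplus> g)) (h \<cdot> g)" (is "_ \<Longrightarrow> ?G2")
proof -
  note b = biproduct_arr[OF f g]
  let ?p1 = "h \<rhd> proj1 C f g" and ?i1 = "h \<rhd> inj1 C f g"
  let ?p2 = "h \<rhd> proj2 C f g" and ?i2 = "h \<rhd> inj2 C f g"
  have hs: "h \<cdot> (f \<oplus> g) \<in> hom1 C X Z" using b(1) h by (rule comp1_hom1)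
  have p: "?p1 \<in> hom2 C (h \<cdot> (f \<oplus> g)) (h \<cdot> f)" "?p2 \<in> hom2 C (h \<cdot> (f \<oplus> g)) (h \<cdot> g)"
    "?i1 \<in> hom2 C (h \<cdot> f) (h \<cdot> (f \<oplus> g))" "?i2 \<in> hom2 C (h \<cdot> g) (h \<cdot> (f \<oplus> g))"
    using whisker_left_hom2[OF h] b f g by blast+
  have arr: "h \<in> Mor1 C" "dom1 C h = Y" "f \<in> Mor1 C" "g \<in> Mor1 C" "cod1 C f = Y" "cod1 C g = Y"
    "f \<oplus> g \<in> Mor1 C" "cod1 C (f \<oplus> g) = Y"
    using h f g b(1) by (auto simp: hom1_def)
  have pi: "?p1 \<odot> ?i1 = id2 C (h \<cdot> f)" "?p2 \<odot> ?i2 = id2 C (h \<cdot> g)"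
    using b(2-7) arr by (simp_all add: hom2_def flip: whisker_left_vcomp)
  have e: "inj1 C f g \<odot> proj1 C f g \<in> hom2 C (f \<oplus> g) (f \<oplus> g)"
    "inj2 C f g \<odot> proj2 C f g \<in> hom2 C (f \<oplus> g) (f \<oplus> g)"
    using vcomp_hom2 b by blast+
  have "h \<rhd> (inj1 C f g \<odot> proj1 C f g) = ?i1 \<odot> ?p1" "h \<rhd> (inj2 C f g \<odot> proj2 C f g) = ?i2 \<odot> ?p2"
    using b(2-5) arr by (simp_all add: hom2_def whisker_left_vcomp)
  then have sum: "(?i1 \<odot> ?p1) \<boxplus> (?i2 \<odot> ?p2) = id2 C (h \<cdot> (f \<oplus> g))"
    using whisker_left_add2[OF h b(1) e] arr biproduct_id2[OF f g] by simp
  \<comment> \<open>The second term of \<open>sum\<close> factors through the zero object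
    \<open>h \<cdot> g\<close> and drops out, so \<open>?i1\<close> is a two-sided inverse of
    \<open>?p1\<close>.\<close>
  show ?G1 if "null1 (h \<cdot> g)"
    using sum add2_zero(1)[OF hs vcomp_hom2[OF p(1,3)] zero_morphism2I[OF that p(2,4)]]
    by (intro iso2I[OF p(1,3) _ pi(1)]) simp
  show ?G2 if "null1 (h \<cdot> f)"
    using sum add2_zero(2)[OF hs vcomp_hom2[OF p(2,4)] zero_morphism2I[OF that p(1,3)]]
    by (intro iso2I[OF p(2,4) _ pi(2)]) simp
qed

text \<open>Serves two purposes: \<open>h = r\<close> yields the counit of the equivalence,
  \<open>h = id1 C P\<close> yields \<open>\<theta>P\<close>. Over each factor one summand vanishes,
  so the whiskered projection onto the other is invertible, and the weak 2-product lifts the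
  resulting pair. The values of \<open>pA \<rhd> \<theta>\<close> and
  \<open>pB \<rhd> \<theta>\<close> are recorded for the matrix equations.\<close>

lemma biproduct_iso2_id1:
  assumes P: "weak_2_product C A B P pA pB" and h: "h \<in> hom1 C W P"
    and f: "f \<in> hom1 C P W" and g: "g \<in> hom1 C P W"
    and \<alpha>: "\<alpha> \<in> iso2 C (pA \<cdot> h \<cdot> f) pA" and \<beta>: "\<beta> \<in> iso2 C (pB \<cdot> h \<cdot> g) pB"
    and nA: "null1 (pA \<cdot> h \<cdot> g)" and nB: "null1 (pB \<cdot> h \<cdot> f)"
  obtains \<theta> where "\<theta> \<in> iso2 C (h \<cdot> (f \<oplus> g)) (id1 C P)"
    "pA \<rhd> \<theta> = \<alpha> \<odot> ((pA \<cdot> h) \<rhd> proj1 C f g)" "pB \<rhd> \<theta> = \<beta> \<odot> ((pB \<cdot> h) \<rhd> proj2 C f g)"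
proof -
  have p: "pA \<in> hom1 C P A" "pB \<in> hom1 C P B" "P \<in> Obj C" using P by (auto simp: weak_2_product_def)
  have ph: "pA \<cdot> h \<in> hom1 C W A" "pB \<cdot> h \<in> hom1 C W B" using comp1_hom1 p h by blast+
  have s: "h \<cdot> (f \<oplus> g) \<in> hom1 C P P" using comp1_hom1[OF biproduct_arr(1)[OF f g] h] .
  have "\<alpha> \<odot> ((pA \<cdot> h) \<rhd> proj1 C f g) \<in> iso2 C (pA \<cdot> (h \<cdot> (f \<oplus> g))) (pA \<cdot> id1 C P)"
    using iso2_vcomp[OF whisker_proj_iso2(1)[OF ph(1) f g nA] \<alpha>] p h biproduct_arr(1)[OF f g]
    by (simp add: hom1_def)
  moreover have "\<beta> \<odot> ((pB \<cdot> h) \<rhd> proj2 C f g) \<in> iso2 C (pB \<cdot> (h \<cdot> (f \<oplus> g))) (pB \<cdot> id1 C P)"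
    using iso2_vcomp[OF whisker_proj_iso2(2)[OF ph(2) f g nB] \<beta>] p h biproduct_arr(1)[OF f g]
    by (simp add: hom1_def)
  ultimately show ?thesis
    using weak_2_product_iso2[OF P s id1_hom1[OF p(3)]] that by metis
qed

end

subsection \<open>Reversing 1-morphisms\<close>

text \<open>Only 1-morphisms are reversed. Weak 2-products and weak 2-coproducts change places,
  while zero objects, biproducts and sums in the Hom-categories stay the same, so dual statements
  come for free.\<close>

definition op1 :: "('o, 'a, 'c, 'z) semiadditive_two_cat_scheme \<Rightarrow> ('o, 'a, 'c, 'z) semiadditive_two_cat_scheme"
  where "op1 C = C\<lparr>dom1 := cod1 C, cod1 := dom1 C, comp1 := \<lambda>g f. comp1 C f g,
    hcomp := \<lambda>\<beta> \<alpha>. hcomp C \<alpha> \<beta>, zero1 := \<lambda>X Y. zero1 C Y X\<rparr>"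

lemma op1_simps [simp]:
  "Obj (op1 C) = Obj C" "Mor1 (op1 C) = Mor1 C" "Mor2 (op1 C) = Mor2 C"
  "dom1 (op1 C) = cod1 C" "cod1 (op1 C) = dom1 C" "dom2 (op1 C) = dom2 C" "cod2 (op1 C) = cod2 C"
  "id1 (op1 C) = id1 C" "id2 (op1 C) = id2 C"
  "comp1 (op1 C) g f = comp1 C f g" "hcomp (op1 C) \<beta> \<alpha> = hcomp C \<alpha> \<beta>" "vcomp (op1 C) = vcomp C"
  "zero1 (op1 C) X Y = zero1 C Y X" "oplus1 (op1 C) = oplus1 C"
  "proj1 (op1 C) = proj1 C" "proj2 (op1 C) = proj2 C" "inj1 (op1 C) = inj1 C" "inj2 (op1 C) = inj2 C"
  by (simp_all add: op1_def)

lemma op1_hom [simp]: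
  "hom1 (op1 C) X Y = hom1 C Y X" "hom2 (op1 C) = hom2 C"
  "inverse2 (op1 C) = inverse2 C" "iso2 (op1 C) = iso2 C" "inv2 (op1 C) = inv2 C"
  "whisker_left (op1 C) f \<alpha> = whisker_right C \<alpha> f" "whisker_right (op1 C) \<alpha> f = whisker_left C f \<alpha>"
  by (auto simp: hom1_def hom2_def inverse2_def iso2_def inv2_def whisker_left_def whisker_right_def
      fun_eq_iff)

lemma op1_semiadditive [simp]:
  "is_zero_object (op1 C) X Y z = is_zero_object C Y X z"
  "is_zero_morphism2 (op1 C) f g \<alpha> = is_zero_morphism2 C f g \<alpha>"
  "is_biproduct (op1 C) f g s \<pi>1 \<pi>2 \<nu>1 \<nu>2 = is_biproduct C f g s \<pi>1 \<pi>2 \<nu>1 \<nu>2"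
  "add2 (op1 C) = add2 C"
  by (auto simp: is_zero_object_def is_zero_morphism2_def is_biproduct_def
      add2_def pair2_def codiag2_def fun_eq_iff)

lemma op1_weak_2_product [simp]:
  "weak_2_product (op1 C) A B P pA pB = weak_2_coproduct C A B P pA pB"
  "weak_2_coproduct (op1 C) A B P pA pB = weak_2_product C A B P pA pB"
  by (simp_all add: weak_2_product_def weak_2_coproduct_def)

lemma op1_two_category:
  assumes "two_category C"
  shows "two_category (op1 C)"
proof -
  interpret two_category C by fact
  show ?thesis
    \<comment> \<open>Every axiom turns into itself or into its left-right mirror image; the
      associativity laws come out reversed.\<close>
    apply (unfold_locales; unfold op1_simps op1_hom)
    subgoal by (rule cod1_Obj)
    subgoal by (rule dom1_Obj)
    subgoal by (rule dom2_Mor1)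
    subgoal by (rule cod2_Mor1)
    subgoal by (rule parallel_cod1)
    subgoal by (rule parallel_dom1)
    subgoal by (rule id1_hom1)
    subgoal by (rule comp1_hom1)
    subgoal by (rule comp1_id1_right)
    subgoal by (rule comp1_id1_left)
    subgoal by (rule comp1_assoc[symmetric])
    subgoal by (rule id2_hom2)
    subgoal by (rule vcomp_hom2)
    subgoal by (rule vcomp_id2_left)
    subgoal by (rule vcomp_id2_right)
    subgoal by (rule vcomp_assoc)
    subgoal by (rule hcomp_hom2)
    subgoal by (rule hcomp_id_right)
    subgoal by (rule hcomp_id_left)
    subgoal by (rule hcomp_assoc[symmetric])
    subgoal by (rule hcomp_id2)
    subgoal by (rule interchange)
    done
qed

lemma (in semiadditive_two_category) op1_semiadditive_two_category:
  "semiadditive_two_category (op1 C)"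
proof -
  interpret op: two_category "op1 C" by (rule op1_two_category) unfold_locales
  have "locally_semiadditive (op1 C)"
    using semiadditive by (simp add: locally_semiadditive_def)
  moreover have "compositionally_distributive (op1 C)"
    unfolding compositionally_distributive_def op1_hom op1_simps op1_semiadditive
    apply (intro conjI ballI)
    subgoal by (rule hcomp_add2_left)
    subgoal by (rule hcomp_add2_right)
    subgoal by (rule vcomp_add2)
    done
  ultimately show ?thesis by unfold_locales
qed

section \<open>Zero 1-morphisms in the presence of a canonical 1-morphism, the equivalence and the
  biproduct\<close>

locale canonical_morphism = semiadditive_two_category C
  for C :: "('o, 'a, 'c, 'z) semiadditive_two_cat_scheme" (structure)
    and A B U iA iB P pA pB r +
  assumes A: "A \<in> Obj C" and B: "B \<in> Obj C"
    and coproduct: "weak_2_coproduct C A B U iA iB"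
    and product: "weak_2_product C A B P pA pB"
    and canonical: "canonical_1_morphism C A B U iA iB P pA pB r"
begin

lemma arrows: "iA \<in> hom1 C A U" "iB \<in> hom1 C B U" "pA \<in> hom1 C P A" "pB \<in> hom1 C P B"
    "r \<in> hom1 C U P" "U \<in> Obj C" "P \<in> Obj C"
  using coproduct product canonical
  by (auto simp: weak_2_coproduct_def weak_2_product_def canonical_1_morphism_def)

text \<open>The situation is self-dual: in \<open>op1 C\<close> the 1-morphism \<open>r\<close> runs
  from the coproduct \<open>P\<close> to the product \<open>U\<close>, and its two off-diagonal
  conditions change places.\<close>

lemma op1_canonical_morphism: "canonical_morphism (op1 C) A B P pA pB U iA iB r"
proof -
  interpret op: semiadditive_two_category "op1 C" by (rule op1_semiadditive_two_category)
  have "canonical_1_morphism (op1 C) A B P pA pB U iA iB r"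
    using canonical comp1_assoc[OF _ arrows(5)] arrows by (simp add: canonical_1_morphism_def)
  then show ?thesis
    using A B coproduct product by unfold_locales simp_all
qed

text \<open>The existence half of the dual of \<open>weak_2_product_ex1\<close>, in the shape that
  \<open>coproduct_comp_null1\<close> asks for.\<close>

lemma coproduct_full:
  assumes "s \<in> hom1 C U Z" "\<sigma> \<in> hom2 C (s \<cdot> iA) (s \<cdot> iA)" "\<tau> \<in> hom2 C (s \<cdot> iB) (s \<cdot> iB)"
  shows "\<exists>\<zeta>. \<zeta> \<in> hom2 C s s \<and> \<zeta> \<lhd> iA = \<sigma> \<and> \<zeta> \<lhd> iB = \<tau>"
proof -
  interpret op: canonical_morphism "op1 C" A B P pA pB U iA iB r by (rule op1_canonical_morphism)
  show ?thesis using op.weak_2_product_ex1[OF op.product] assms by simp blast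
qed

lemma comp_null1_coproduct:
  assumes s: "s \<in> hom1 C U Z" and w: "null1 w" "w \<in> hom1 C Q U" and Q: "Q = A \<or> Q = B"
  shows "null1 (s \<cdot> w)"
proof -
  have Z: "Z \<in> Obj C" using hom1_Obj[OF s] by simp
  \<comment> \<open>The chosen zero 1-morphisms supply \<open>z\<close>, \<open>a\<close> and
    \<open>b\<close> of \<open>coproduct_comp_null1\<close>.\<close>
  note zA = null1_zero1[OF A Z] and zB = null1_zero1[OF B Z]
    and aA = null1_zero1[OF A A] and aB = null1_zero1[OF B B]
    and bA = null1_zero1(2)[OF A B] and bB = null1_zero1(2)[OF B A]
  show ?thesis using Q
  proof
    assume "Q = A"
    then show ?thesis
      using coproduct_comp_null1[OF arrows(1,2) coproduct_full[OF s] s w(1) _ zA aA bA] w(2) by simp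
  next
    assume "Q = B"
    \<comment> \<open>For \<open>B\<close> the two summands are interchanged: now
      \<open>\<zeta>\<close> is zero on \<open>B\<close> and the identity on
      \<open>A\<close>.\<close>
    moreover have "\<exists>\<zeta>. \<zeta> \<in> hom2 C s s \<and> \<zeta> \<lhd> iB = \<sigma> \<and> \<zeta> \<lhd> iA = \<tau>"
      if "\<sigma> \<in> hom2 C (s \<cdot> iB) (s \<cdot> iB)" "\<tau> \<in> hom2 C (s \<cdot> iA) (s \<cdot> iA)" for \<sigma> \<tau>
      using coproduct_full[OF s that(2,1)] by blast
    ultimately show ?thesis
      using coproduct_comp_null1[OF arrows(2,1) _ s w(1) _ zB aB bB] w(2) by simp
  qed
qed

text \<open>Any zero \<open>w\<close> into \<open>Y = A\<close> or \<open>B\<close> is isomorphic to \<open>q \<cdot> 0\<close> with \<open>q = pA \<cdot> r\<close> or \<open>pB \<cdot> r\<close>.\<close>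
lemma comp_null1:
  assumes f: "f \<in> hom1 C Y Z" and w: "null1 w" "w \<in> hom1 C Q Y"
    and Y: "Y = A \<or> Y = B" and Q: "Q = A \<or> Q = B"
  shows "null1 (f \<cdot> w)"
proof -
  obtain q where q: "q \<in> hom1 C U Y"
    using Y comp1_hom1[OF arrows(5) arrows(3)] comp1_hom1[OF arrows(5) arrows(4)] by blast
  have "Q \<in> Obj C" using Q A B by blast
  note u = null1_zero1[OF this arrows(6)]
  have qu: "null1 (q \<cdot> zero1 C U Q)" "q \<cdot> zero1 C U Q \<in> hom1 C Q Y"
    using comp_null1_coproduct[OF q u Q] comp1_hom1[OF u(2) q] by blast+
  obtain \<alpha> where "\<alpha> \<in> iso2 C w (q \<cdot> zero1 C U Q)"
    using null1_iso2[OF w(1) qu(1) w(2) qu(2)] .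
  then have "f \<rhd> \<alpha> \<in> iso2 C (f \<cdot> w) (f \<cdot> (q \<cdot> zero1 C U Q))"
    using iso2_whisker_left[OF f w(2)] by blast
  \<comment> \<open>\<open>f \<cdot> q\<close> again starts at the coproduct \<open>U\<close>, so
    the case already settled applies to it.\<close>
  moreover have "null1 ((f \<cdot> q) \<cdot> zero1 C U Q)"
    using comp_null1_coproduct[OF comp1_hom1[OF q f] u Q] .
  ultimately show ?thesis
    using null1_iso comp1_assoc[OF u(2) q f] by simp
qed

lemma null1_op1: "two_category.null1 (op1 C) f \<longleftrightarrow> null1 f"
proof -
  interpret op: two_category "op1 C" by (rule op1_two_category) unfold_locales
  show ?thesis by (simp add: op.null1_def null1_def)
qed

text \<open>The dual of \<open>comp_null1\<close>: these zero 1-morphisms also absorb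
  precomposition.\<close>

lemma null1_comp:
  assumes f: "f \<in> hom1 C Z Y" and w: "null1 w" "w \<in> hom1 C Y Q"
    and Y: "Y = A \<or> Y = B" and Q: "Q = A \<or> Q = B"
  shows "null1 (w \<cdot> f)"
proof -
  interpret op: canonical_morphism "op1 C" A B P pA pB U iA iB r by (rule op1_canonical_morphism)
  show ?thesis using op.comp_null1[of f Y Z w Q] assms by (simp add: null1_op1)
qed

lemma canonical_iso2:
  obtains \<theta>A \<theta>B \<theta>AB \<theta>BA where
    "\<theta>A \<in> iso2 C (pA \<cdot> (r \<cdot> iA)) (id1 C A)" "\<theta>B \<in> iso2 C (pB \<cdot> (r \<cdot> iB)) (id1 C B)"
    "\<theta>AB \<in> iso2 C (pA \<cdot> (r \<cdot> iB)) (zero1 C A B)" "\<theta>BA \<in> iso2 C (pB \<cdot> (r \<cdot> iA)) (zero1 C B A)"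
  using canonical comp1_assoc[OF _ arrows(5)] arrows by (auto simp: canonical_1_morphism_def)

text \<open>The factor \<open>pA \<cdot> (r \<cdot> iB)\<close> is zero because \<open>r\<close> is
  canonical, and by \<open>null1_comp\<close> it stays zero after precomposition with
  \<open>pB\<close>; likewise with \<open>A\<close> and \<open>B\<close> exchanged.\<close>

lemma null1_off_diagonal:
  "null1 (pA \<cdot> (r \<cdot> iB) \<cdot> pB)" "null1 (pB \<cdot> (r \<cdot> iA) \<cdot> pA)"
proof -
  obtain \<theta>AB \<theta>BA where
    t: "\<theta>AB \<in> iso2 C (pA \<cdot> (r \<cdot> iB)) (zero1 C A B)" "\<theta>BA \<in> iso2 C (pB \<cdot> (r \<cdot> iA)) (zero1 C B A)"
    by (rule canonical_iso2)
  have "pA \<cdot> (r \<cdot> iB) \<in> hom1 C B A" "pB \<cdot> (r \<cdot> iA) \<in> hom1 C A B"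
    using arrows comp1_hom1 by blast+
  then show "null1 (pA \<cdot> (r \<cdot> iB) \<cdot> pB)" "null1 (pB \<cdot> (r \<cdot> iA) \<cdot> pA)"
    using null1_comp null1_iso[OF null1_zero1(1) t(1)] null1_iso[OF null1_zero1(1) t(2)] A B arrows
    by blast+
qed

lemma equivalence_counit:
  "iso2 C (r \<cdot> (iA \<cdot> pA \<oplus> iB \<cdot> pB)) (id1 C P) \<noteq> {}"
proof -
  obtain \<theta>A \<theta>B where
    t: "\<theta>A \<in> iso2 C (pA \<cdot> (r \<cdot> iA)) (id1 C A)" "\<theta>B \<in> iso2 C (pB \<cdot> (r \<cdot> iB)) (id1 C B)"
    by (rule canonical_iso2)
  have c: "pA \<cdot> (r \<cdot> iA) \<in> hom1 C A A" "pB \<cdot> (r \<cdot> iB) \<in> hom1 C B B"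
    "iA \<cdot> pA \<in> hom1 C P U" "iB \<cdot> pB \<in> hom1 C P U"
    using arrows comp1_hom1 by blast+
  have "\<theta>A \<lhd> pA \<in> iso2 C (pA \<cdot> r \<cdot> (iA \<cdot> pA)) pA" "\<theta>B \<lhd> pB \<in> iso2 C (pB \<cdot> r \<cdot> (iB \<cdot> pB)) pB"
    using iso2_whisker_right[OF arrows(3) c(1) t(1)] iso2_whisker_right[OF arrows(4) c(2) t(2)]
      arrows A B by (simp_all add: hom1_def)
  moreover have "null1 (pA \<cdot> r \<cdot> (iB \<cdot> pB))" "null1 (pB \<cdot> r \<cdot> (iA \<cdot> pA))"
    using null1_off_diagonal arrows by (simp_all add: hom1_def)
  ultimately show ?thesis
    using biproduct_iso2_id1[OF product arrows(5) c(3,4)] by blast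
qed

lemma equivalence: "is_equivalence C U P r"
proof -
  interpret op: canonical_morphism "op1 C" A B P pA pB U iA iB r by (rule op1_canonical_morphism)
  let ?r' = "iA \<cdot> pA \<oplus> iB \<cdot> pB"
  have r': "?r' \<in> hom1 C P U"
    using biproduct_arr(1) comp1_hom1 arrows by blast
  obtain \<alpha> where a: "\<alpha> \<in> iso2 C (r \<cdot> ?r') (id1 C P)" using equivalence_counit by blast
  \<comment> \<open>The expression \<open>?r'\<close> is the same 1-morphism when formed in
    \<open>op1 C\<close>. Hence the dual of the counit is a 2-isomorphism at \<open>U\<close>, and
    its inverse is the unit.\<close>
  obtain \<beta> where "\<beta> \<in> iso2 C (?r' \<cdot> r) (id1 C U)" using op.equivalence_counit by auto
  then obtain \<beta>' where "\<beta>' \<in> iso2 C (id1 C U) (?r' \<cdot> r)" by (rule iso2E)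
  then show ?thesis using is_equivalenceI[OF arrows(5) r' a] by blast
qed

lemma biproduct_exists:
  "\<exists>\<theta>A \<theta>B \<theta>AB \<theta>BA \<theta>P.
    weak_2_biproduct C A B P pA pB (r \<cdot> iA) (r \<cdot> iB) \<theta>A \<theta>B \<theta>AB \<theta>BA \<theta>P"
proof -
  obtain \<theta>A \<theta>B \<theta>AB \<theta>BA where t:
    "\<theta>A \<in> iso2 C (pA \<cdot> (r \<cdot> iA)) (id1 C A)" "\<theta>B \<in> iso2 C (pB \<cdot> (r \<cdot> iB)) (id1 C B)"
    "\<theta>AB \<in> iso2 C (pA \<cdot> (r \<cdot> iB)) (zero1 C A B)" "\<theta>BA \<in> iso2 C (pB \<cdot> (r \<cdot> iA)) (zero1 C B A)"
    by (rule canonical_iso2)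
  \<comment> \<open>The injections are kept opaque, so that associativity does not break them up
    inside \<open>jA \<cdot> pA\<close> and \<open>jB \<cdot> pB\<close>.\<close>
  define jA jB where j_def: "jA = r \<cdot> iA" "jB = r \<cdot> iB"
  have j: "jA \<in> hom1 C A P" "jB \<in> hom1 C B P" using arrows comp1_hom1 unfolding j_def by blast+
  note t' = t[folded j_def]
  let ?f = "jA \<cdot> pA" and ?g = "jB \<cdot> pB"
  have fg: "?f \<in> hom1 C P P" "?g \<in> hom1 C P P" and c: "pA \<cdot> jA \<in> hom1 C A A" "pB \<cdot> jB \<in> hom1 C B B"
    using arrows j comp1_hom1 by blast+
  note b = biproduct_arr[OF fg]
  \<comment> \<open>The identity of \<open>P\<close> is written out as the \<open>h\<close> of
    \<open>biproduct_iso2_id1\<close>; these are the diagonal components of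
    \<open>\<theta>P\<close>.\<close>
  have "\<theta>A \<lhd> pA \<in> iso2 C (pA \<cdot> id1 C P \<cdot> ?f) pA" "\<theta>B \<lhd> pB \<in> iso2 C (pB \<cdot> id1 C P \<cdot> ?g) pB"
    using iso2_whisker_right[OF arrows(3) c(1) t'(1)] iso2_whisker_right[OF arrows(4) c(2) t'(2)]
      arrows j A B by (simp_all add: hom1_def)
  moreover have "null1 (pA \<cdot> id1 C P \<cdot> ?g)" "null1 (pB \<cdot> id1 C P \<cdot> ?f)"
    using null1_off_diagonal[folded j_def] arrows j by (simp_all add: hom1_def)
  ultimately obtain \<theta>P where p: "\<theta>P \<in> iso2 C (id1 C P \<cdot> (?f \<oplus> ?g)) (id1 C P)"
    "pA \<rhd> \<theta>P = (\<theta>A \<lhd> pA) \<odot> ((pA \<cdot> id1 C P) \<rhd> proj1 C ?f ?g)"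
    "pB \<rhd> \<theta>P = (\<theta>B \<lhd> pB) \<odot> ((pB \<cdot> id1 C P) \<rhd> proj2 C ?f ?g)"
    by (rule biproduct_iso2_id1[OF product id1_hom1[OF arrows(7)] fg])
  have p1: "\<theta>P \<in> iso2 C (?f \<oplus> ?g) (id1 C P)" using p(1) b(1) by (simp add: hom1_def)
  have tA: "\<theta>A \<in> hom2 C (pA \<cdot> jA) (id1 C A)" and tB: "\<theta>B \<in> hom2 C (pB \<cdot> jB) (id1 C B)"
    using t' iso2_hom2 by auto
  have "pA \<rhd> (\<theta>P \<lhd> jA) = (pA \<rhd> \<theta>P) \<lhd> jA" "pB \<rhd> (\<theta>P \<lhd> jB) = (pB \<rhd> \<theta>P) \<lhd> jB"
    using iso2_hom2[OF p1] arrows j b(1) by (simp_all add: hom1_def hom2_def)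
  then have "pA \<rhd> (\<theta>P \<lhd> jA) = (\<theta>A \<lhd> (pA \<cdot> jA)) \<odot> (pA \<rhd> (proj1 C ?f ?g \<lhd> jA))"
    "pB \<rhd> (\<theta>P \<lhd> jB) = (\<theta>B \<lhd> (pB \<cdot> jB)) \<odot> (pB \<rhd> (proj2 C ?f ?g \<lhd> jB))"
    unfolding p(2,3) using tA tB b(1-3) arrows j A B
    by (simp_all add: hom1_def hom2_def whisker_right_vcomp)
  \<comment> \<open>The lift produces \<open>\<theta>A\<close> whiskered on the right, the matrix
    equation has it whiskered on the left. The two agree because \<open>\<theta>A\<close> is an
    isomorphism onto an identity 1-morphism; the same holds for \<open>\<theta>B\<close>.\<close>
  then have m: "pA \<rhd> (\<theta>P \<lhd> jA) = ((pA \<cdot> jA) \<rhd> \<theta>A) \<odot> (pA \<rhd> (proj1 C ?f ?g \<lhd> jA))"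
    "pB \<rhd> (\<theta>P \<lhd> jB) = ((pB \<cdot> jB) \<rhd> \<theta>B) \<odot> (pB \<rhd> (proj2 C ?f ?g \<lhd> jB))"
    unfolding whisker_iso_id1_commute[OF c(1) t'(1)] whisker_iso_id1_commute[OF c(2) t'(2)] .
  have "weak_2_biproduct C A B P pA pB jA jB \<theta>A \<theta>B \<theta>AB \<theta>BA \<theta>P"
    unfolding weak_2_biproduct_def by (intro conjI) (fact arrows j t' p1 m)+
  then show ?thesis unfolding j_def by blast
qed

end

theorem proposition7:
  fixes C :: "('o, 'a, 'c, 'z) semiadditive_two_cat_scheme" (structure)
    and A B U P :: 'o and iA iB pA pB r :: 'a
  assumes "two_category C"
    and "locally_semiadditive C"
    and "compositionally_distributive C"
    and "A \<in> Obj C" and "B \<in> Obj C"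
    and "weak_2_coproduct C A B U iA iB"
    and "weak_2_product C A B P pA pB"
    and "canonical_1_morphism C A B U iA iB P pA pB r"
  shows "is_equivalence C U P r \<longleftrightarrow>
    (\<exists>\<theta>A \<theta>B \<theta>AB \<theta>BA \<theta>P.
      weak_2_biproduct C A B P pA pB (r \<cdot> iA) (r \<cdot> iB) \<theta>A \<theta>B \<theta>AB \<theta>BA \<theta>P)"
proof -
  interpret canonical_morphism C A B U iA iB P pA pB r
    using assms by (simp add: canonical_morphism_def canonical_morphism_axioms_def
      semiadditive_two_category_def semiadditive_two_category_axioms_def)
  show ?thesis using equivalence biproduct_exists by blast
qed

end
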